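(* Let $n\ge1$, $-1=x_0<x_1<\dots<x_{n+1}=1$, $\tau_j=(x_{j-1},x_j)$, $h_j=x_j-x_{j-1}$, and let $c$ be piecewise constant with $c=c_j>0$ on $\tau_j$ for $1\le j\le n+1$; put $c_{\min}=\min_jc_j$, $c_{\max}=\max_jc_j$. Let $\omega\ge\omega_0>0$ and $g_1,g_2\in\mathbb{C}$. Then the solution $u$ of $$-u''-\left(\tfrac{\omega}{c}\right)^2u=0\ \text{ in }\Omega=(-1,1),\qquad -u'-\mathrm{i}\tfrac{\omega}{c_1}u=g_1\ \text{ at }x=-1,\qquad u'-\mathrm{i}\tfrac{\omega}{c_{n+1}}u=g_2\ \text{ at }x=1$$ satisfies, for $k=0,1,2$, $$\|u^{(k)}\|_{L^2(\Omega)}\le 4\,\frac{c_{\max}}{c_{\min}^k}\,\omega^{k-1}\max\{|g_1|,|g_2|\}\,\max_{1\le j\le n}\frac{1}{\sqrt{1-|Q_j|^2}},$$ where the numbers $Q_j$ are defined recursively in the context.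
   Context: Define $\sigma_j:=\exp\left(-2\mathrm{i}\frac{h_{j+1}\omega}{c_{j+1}}\right)$ for $0\le j\le n$ and $q_j:=\frac{c_{j+1}-c_j}{c_{j+1}+c_j}\in(-1,1)$ for $1\le j\le n$. The complex sequence $Q_j$ is defined by $$Q_1=\frac{q_1}{\sigma_1},\qquad Q_j=\frac{q_j+Q_{j-1}}{\sigma_j(1+q_jQ_{j-1})},\quad 2\le j\le n;$$ one has $|Q_j|<1$, so everything is well defined. The solution is the unique $u\in H^1(\Omega)$ with $$\int_\Omega\left(u'\bar v'-\left(\tfrac{\omega}{c}\right)^2u\bar v\right)-\mathrm{i}\sum_{x\in\{-1,1\}}\tfrac{\omega}{c(x)}u(x)\bar v(x)=g_1\bar v(-1)+g_2\bar v(1)\qquad\forall v\in H^1(\Omega),$$ where $c(-1)=c_1$, $c(1)=c_{n+1}$. *)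

theory Defs
  imports "HOL-Analysis.Analysis"
begin

definition square_integrable_on :: "(real \<Rightarrow> complex) \<Rightarrow> real set \<Rightarrow> bool"
    (infixr "square'_integrable'_on" 46) where
  "f square_integrable_on S \<longleftrightarrow>
     f \<in> borel_measurable (lebesgue_on S) \<and> integrable (lebesgue_on S) (\<lambda>t. (cmod (f t))\<^sup>2)"

definition L2_norm_on :: "real set \<Rightarrow> (real \<Rightarrow> complex) \<Rightarrow> real" where
  "L2_norm_on S f = sqrt (LINT t|lebesgue_on S. (cmod (f t))\<^sup>2)"

definition locally_integrable_on :: "(real \<Rightarrow> complex) \<Rightarrow> real set \<Rightarrow> bool"
    (infixr "locally'_integrable'_on" 46) where
  "f locally_integrable_on S \<longleftrightarrow> (\<forall>K. compact K \<and> K \<subseteq> S \<longrightarrow> integrable (lebesgue_on K) f)"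

definition test_functions :: "real set \<Rightarrow> (real \<Rightarrow> real) set" where
  "test_functions S = {\<phi>. (\<forall>m t. ((deriv ^^ m) \<phi>) field_differentiable (at t)) \<and>
                          (\<exists>K. compact K \<and> K \<subseteq> S \<and> (\<forall>t. t \<notin> K \<longrightarrow> \<phi> t = 0))}"

definition has_weak_deriv ::
    "real set \<Rightarrow> nat \<Rightarrow> (real \<Rightarrow> complex) \<Rightarrow> (real \<Rightarrow> complex) \<Rightarrow> bool" where
  "has_weak_deriv S k u w \<longleftrightarrow>
     u locally_integrable_on S \<and> w locally_integrable_on S \<and>
     (\<forall>\<phi>\<in>test_functions S.
        (LINT t|lebesgue_on S. u t * of_real ((deriv ^^ k) \<phi> t)) =
        (-1) ^ k * (LINT t|lebesgue_on S. w t * of_real (\<phi> t)))"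

(* Weak derivatives are unique only up to null sets; weak_deriv picks an arbitrary
   representative and is meant to be used under integrals only. *)
definition weak_deriv :: "real set \<Rightarrow> nat \<Rightarrow> (real \<Rightarrow> complex) \<Rightarrow> real \<Rightarrow> complex" where
  "weak_deriv S k u = (SOME w. has_weak_deriv S k u w)"

definition sobolev :: "real set \<Rightarrow> nat \<Rightarrow> (real \<Rightarrow> complex) set" where
  "sobolev S k = {u. u square_integrable_on S \<and>
     (\<forall>j\<in>{1..k}. \<exists>w. has_weak_deriv S j u w \<and> w square_integrable_on S)}"

abbreviation Omega :: "real set" where
  "Omega \<equiv> {-1<..<1}"

(* Every class in the Sobolev space of order one on a bounded interval has exactly one
   representative that is continuous up to the closed interval. Elements of that space are
   given by this representative, so that their boundary values are point evaluations. *)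
definition H1_Omega :: "(real \<Rightarrow> complex) set" where
  "H1_Omega = {u. u \<in> sobolev Omega 1 \<and> continuous_on {-1..1} u}"

(* Weak form of  - u'' - (omega/c)^2 u = 0  in (-1,1)  with the impedance conditions
   - u' - i (omega/c(-1)) u = g1  at  -1  and  u' - i (omega/c(1)) u = g2  at  1.
   The values c(-1) and c(1) are the one-sided limits of the coefficient. *)
definition helmholtz_solution ::
    "(real \<Rightarrow> real) \<Rightarrow> real \<Rightarrow> complex \<Rightarrow> complex \<Rightarrow> (real \<Rightarrow> complex) \<Rightarrow> bool" where
  "helmholtz_solution c \<omega> g1 g2 u \<longleftrightarrow> u \<in> H1_Omega \<and>
     (\<forall>v\<in>H1_Omega.
        (LINT t|lebesgue_on Omega.
            weak_deriv Omega 1 u t * cnj (weak_deriv Omega 1 v t)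
            - of_real ((\<omega> / c t)\<^sup>2) * u t * cnj (v t))
        - \<i> * (\<Sum>t\<in>{-1, 1}. of_real (\<omega> / c t) * u t * cnj (v t))
        = g1 * cnj (v (-1)) + g2 * cnj (v 1))"

definition sigma :: "(nat \<Rightarrow> real) \<Rightarrow> (nat \<Rightarrow> real) \<Rightarrow> real \<Rightarrow> nat \<Rightarrow> complex" where
  "sigma x c \<omega> j = exp (- 2 * \<i> * of_real ((x (j + 1) - x j) * \<omega> / c (j + 1)))"

definition jump_ratio :: "(nat \<Rightarrow> real) \<Rightarrow> nat \<Rightarrow> real" where
  "jump_ratio c j = (c (j + 1) - c j) / (c (j + 1) + c j)"

(* The sequence starts at index 1; the value at 0 is a dummy. *)
fun Qseq :: "(nat \<Rightarrow> real) \<Rightarrow> (nat \<Rightarrow> real) \<Rightarrow> real \<Rightarrow> nat \<Rightarrow> complex" where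
  "Qseq x c \<omega> 0 = 0"
| "Qseq x c \<omega> (Suc 0) = of_real (jump_ratio c 1) / sigma x c \<omega> 1"
| "Qseq x c \<omega> (Suc (Suc j)) =
     (of_real (jump_ratio c (Suc (Suc j))) + Qseq x c \<omega> (Suc j)) /
     (sigma x c \<omega> (Suc (Suc j)) *
        (1 + of_real (jump_ratio c (Suc (Suc j))) * Qseq x c \<omega> (Suc j)))"

end

theory Submission
  imports Defs
begin

text \<open>
  The weak solution is tested with the constant 1 and with the ramps
  \<open>v t = max 0 (t - s)\<close>; this gives an integral formula for \<open>u\<close>, so that \<open>u\<close> is continuously
  differentiable and, on each layer, a superposition of a right-going wave \<open>A\<close> and a left-going
  wave \<open>B\<close> of constant moduli. Two facts then bound the amplitudes. The flux
  \<open>(|A|\<^sup>2 - |B|\<^sup>2) / c\<close> is the same on all layers, and at the right end, where \<open>B\<close> is prescribed by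
  \<open>g2\<close>, it is at least \<open>- |B|\<^sup>2 / c\<close>. The number \<open>Q\<^bsub>j\<^esub>\<close> is, up to sign, the reflection coefficient of everything
  to the left of layer \<open>j + 1\<close>, so the recursion for \<open>Q\<^bsub>j\<^esub>\<close> makes
  \<open>|A + Q\<^bsub>j\<^esub> B|\<^sup>2 / (c (1 - |Q\<^bsub>j\<^esub>|\<^sup>2))\<close> independent of the layer, with value given by \<open>g1\<close>. With
  \<open>N = c\<^bsub>max\<^esub> max {|g1|, |g2|} / (2 \<omega>)\<close> and \<open>p = |Q\<^bsub>j\<^esub>|\<close> this reads \<open>|A| \<le> p |B| + sqrt (1 - p\<^sup>2) N\<close>
  and \<open>|B|\<^sup>2 - |A|\<^sup>2 \<le> N\<^sup>2\<close>, whence \<open>|A| + |B| \<le> 2 (1 + sqrt 2) N / sqrt (1 - p\<^sup>2)\<close>. Since \<open>\<Omega>\<close> has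
  length 2, the constant becomes \<open>2 + sqrt 2 \<le> 4\<close>.
\<close>

section \<open>A smooth step function\<close>

text \<open>The powers of 1/t make the family closed under differentiation up to linear
  combinations; \<open>flat_exp 0\<close> is the classical function that is smooth but not analytic
  at 0.\<close>

definition flat_exp :: "nat \<Rightarrow> real \<Rightarrow> real" where
  "flat_exp k t = (if t > 0 then exp (- inverse t) * inverse t ^ k else 0)"

lemma flat_exp_tendsto_0: "(flat_exp k \<longlongrightarrow> 0) (at 0)"
proof -
  have "((\<lambda>t. inverse t ^ k / exp (inverse t)) \<longlongrightarrow> 0) (at_right (0::real))"
    by (rule filterlim_compose[OF tendsto_power_div_exp_0 filterlim_inverse_at_top_right])
  then have "(flat_exp k \<longlongrightarrow> 0) (at_right 0)"
    by (rule Lim_transform_eventually)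
      (auto simp: flat_exp_def eventually_at_filter exp_minus field_simps)
  moreover have "(flat_exp k \<longlongrightarrow> 0) (at_left 0)"
    by (rule Lim_transform_eventually[OF tendsto_const])
      (auto simp: flat_exp_def eventually_at_filter)
  ultimately show ?thesis
    by (simp add: filterlim_split_at)
qed

lemma flat_exp_deriv:
  "(flat_exp k has_real_derivative flat_exp (k + 2) t - real k * flat_exp (k + 1) t) (at t)"
proof (cases t "0::real" rule: linorder_cases)
  case less
  have "((\<lambda>_. 0) has_real_derivative 0) (at t)"
    by simp
  then have "(flat_exp k has_real_derivative 0) (at t)"
    by (rule has_field_derivative_transform_within_open[where S="{..<0}"])
      (use less in \<open>auto simp: flat_exp_def\<close>)
  with less show ?thesis
    by (simp add: flat_exp_def)
next
  case equal
  \<comment> \<open>The difference quotient of \<open>flat_exp k\<close> at 0 is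
    \<open>flat_exp (k + 1)\<close> itself, so differentiability at the origin is a limit already
    known.\<close>
  have "((\<lambda>y. flat_exp (k + 1) y) \<longlongrightarrow> 0) (at 0)"
    by (rule flat_exp_tendsto_0)
  then have "((\<lambda>y. (flat_exp k y - flat_exp k 0) / (y - 0)) \<longlongrightarrow> 0) (at 0)"
    by (rule Lim_transform_eventually) (auto simp: flat_exp_def eventually_at_filter field_simps)
  with equal show ?thesis
    by (simp add: has_field_derivative_iff flat_exp_def)
next
  case greater
  have "((\<lambda>t. exp (- inverse t) * inverse t ^ k) has_real_derivative
      exp (- inverse t) * inverse t ^ (k + 2) - real k * (exp (- inverse t) * inverse t ^ (k + 1))) (at t)"
  \<comment> \<open>The case split removes the truncated exponent k - 1 that the power rule
    produces.\<close>
  proof (cases k)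
    case 0
    with greater show ?thesis
      by (auto intro!: derivative_eq_intros simp: power2_eq_square)
  next
    case (Suc m)
    with greater show ?thesis
      by (auto intro!: derivative_eq_intros simp: algebra_simps simp flip: power_Suc)
  qed
  then have "(flat_exp k has_real_derivative
      exp (- inverse t) * inverse t ^ (k + 2) - real k * (exp (- inverse t) * inverse t ^ (k + 1))) (at t)"
    by (rule has_field_derivative_transform_within_open[where S="{0<..}"])
      (use greater in \<open>auto simp: flat_exp_def\<close>)
  with greater show ?thesis
    by (simp add: flat_exp_def)
qed

text \<open>The generators are closed under differentiation, hence so is the whole set, and all its members
  are smooth.\<close>
inductive_set smooth_closure :: "(real \<Rightarrow> real) set" where
  const: "(\<lambda>_. a) \<in> smooth_closure"
| flat: "(\<lambda>t. flat_exp k (a * t + b)) \<in> smooth_closure"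
| add: "f \<in> smooth_closure \<Longrightarrow> g \<in> smooth_closure \<Longrightarrow> (\<lambda>t. f t + g t) \<in> smooth_closure"
| mult: "f \<in> smooth_closure \<Longrightarrow> g \<in> smooth_closure \<Longrightarrow> (\<lambda>t. f t * g t) \<in> smooth_closure"
| inverse: "f \<in> smooth_closure \<Longrightarrow> (\<And>t. f t \<noteq> 0) \<Longrightarrow> (\<lambda>t. inverse (f t)) \<in> smooth_closure"

lemma smooth_closure_deriv:
  assumes "f \<in> smooth_closure"
  shows "\<exists>f'\<in>smooth_closure. \<forall>t. (f has_real_derivative f' t) (at t)"
  using assms
proof induction
  case (const a)
  show ?case
    by (intro bexI[where x="\<lambda>_. 0"]) (auto intro: smooth_closure.const)
next
  case (flat k a b)
  \<comment> \<open>Subtraction is written as adding a product with \<open>- real k\<close>, so that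
    the introduction rules of \<open>smooth_closure\<close> apply literally.\<close>
  let ?f' = "\<lambda>t. a * (flat_exp (k + 2) (a * t + b) + (- real k) * flat_exp (k + 1) (a * t + b))"
  have "((\<lambda>t. flat_exp k (a * t + b)) has_real_derivative ?f' t) (at t)" for t
  proof -
    have "((\<lambda>t. a * t + b) has_real_derivative a) (at t)"
      by (auto intro!: derivative_eq_intros)
    from DERIV_chain2[OF flat_exp_deriv this] show ?thesis
      by (simp add: algebra_simps)
  qed
  moreover have "?f' \<in> smooth_closure"
    by (intro smooth_closure.intros)
  ultimately show ?case
    by (intro bexI[where x="?f'"]) auto
next
  case (add f g)
  then obtain f' g' where "f' \<in> smooth_closure" "g' \<in> smooth_closure"
    "\<forall>t. (f has_real_derivative f' t) (at t)" "\<forall>t. (g has_real_derivative g' t) (at t)"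
    by blast
  then show ?case
    by (intro bexI[where x="\<lambda>t. f' t + g' t"])
      (auto intro!: derivative_eq_intros smooth_closure.add)
next
  case (mult f g)
  then obtain f' g' where "f' \<in> smooth_closure" "g' \<in> smooth_closure"
    "\<forall>t. (f has_real_derivative f' t) (at t)" "\<forall>t. (g has_real_derivative g' t) (at t)"
    by blast
  with mult show ?case
    by (intro bexI[where x="\<lambda>t. f' t * g t + g' t * f t"])
      (auto intro!: DERIV_mult smooth_closure.add smooth_closure.mult)
next
  case (inverse f)
  then obtain f' where f': "f' \<in> smooth_closure" "\<forall>t. (f has_real_derivative f' t) (at t)"
    by blast
  let ?g = "\<lambda>t. (-1) * (f' t * (inverse (f t) * inverse (f t)))"
  have "((\<lambda>t. inverse (f t)) has_real_derivative ?g t) (at t)" for t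
    using DERIV_inverse'[OF f'(2)[rule_format] inverse.hyps(2)[of t]] by (simp add: ac_simps)
  moreover have "?g \<in> smooth_closure"
    using f'(1) inverse.hyps
    by (intro smooth_closure.mult smooth_closure.const smooth_closure.inverse)
  ultimately show ?case
    by (intro bexI[where x="?g"]) auto
qed

lemma smooth_closure_higher_deriv:
  assumes "f \<in> smooth_closure"
  shows "(deriv ^^ m) f \<in> smooth_closure"
proof (induction m)
  case (Suc m)
  then obtain f' where "f' \<in> smooth_closure" "\<forall>t. ((deriv ^^ m) f has_real_derivative f' t) (at t)"
    using smooth_closure_deriv by blast
  then have "deriv ((deriv ^^ m) f) = f'"
    by (intro ext DERIV_imp_deriv) blast
  with \<open>f' \<in> smooth_closure\<close> show ?case
    by simp
qed (use assms in simp)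

lemma smooth_closure_differentiable:
  assumes "f \<in> smooth_closure"
  shows "((deriv ^^ m) f) field_differentiable (at t)"
  using smooth_closure_deriv[OF smooth_closure_higher_deriv[OF assms]]
  by (auto simp: field_differentiable_def)

text \<open>The usual smooth transition from 0 on t <= 0 to 1 on t >= 1. Differences of its rescaled
  translates approximate indicators of intervals, and its derivative is the kernel of an approximate
  identity.\<close>

definition smooth_step :: "real \<Rightarrow> real" where
  "smooth_step t = flat_exp 0 t / (flat_exp 0 t + flat_exp 0 (1 - t))"

lemma smooth_step_denominator: "flat_exp 0 t + flat_exp 0 (1 - t) > 0"
  by (cases "t > 0") (auto simp: flat_exp_def add_pos_nonneg)

lemma smooth_step_affine_smooth: "(\<lambda>t. smooth_step (a * t + b)) \<in> smooth_closure"
proof -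
  have 1: "(\<lambda>t. flat_exp 0 (1 - (a * t + b))) = (\<lambda>t. flat_exp 0 ((-a) * t + (1 - b)))"
    by (simp add: algebra_simps)
  have 2: "flat_exp 0 t + flat_exp 0 (1 - t) \<noteq> 0" for t
    using smooth_step_denominator[of t] by simp
  show ?thesis
    unfolding smooth_step_def divide_inverse
    by (intro smooth_closure.mult smooth_closure.inverse smooth_closure.add smooth_closure.flat
        2 1[THEN ssubst])
qed

lemma smooth_step_eq_0: "t \<le> 0 \<Longrightarrow> smooth_step t = 0"
  by (simp add: smooth_step_def flat_exp_def)

lemma smooth_step_eq_1: "t \<ge> 1 \<Longrightarrow> smooth_step t = 1"
  by (simp add: smooth_step_def flat_exp_def)

lemma smooth_step_bounds: "0 \<le> smooth_step t" "smooth_step t \<le> 1"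
  using smooth_step_denominator[of t]
  by (auto simp: smooth_step_def divide_simps) (auto simp: flat_exp_def)

lemma smooth_step_deriv: "(smooth_step has_real_derivative deriv smooth_step t) (at t)"
  and continuous_on_deriv_smooth_step: "continuous_on S (deriv smooth_step)"
proof -
  have G: "smooth_step \<in> smooth_closure"
    using smooth_step_affine_smooth[of 1 0] by simp
  show "(smooth_step has_real_derivative deriv smooth_step t) (at t)"
    using smooth_closure_differentiable[OF G, of 0 t] by (simp add: DERIV_deriv_iff_field_differentiable)
  have "(deriv smooth_step) field_differentiable (at t)" for t
    using smooth_closure_differentiable[OF G, of 1 t] by simp
  then show "continuous_on S (deriv smooth_step)"
    by (meson continuous_at_imp_continuous_on field_differentiable_imp_continuous_at)
qed

lemma deriv_smooth_step_eq_0: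
  assumes "t \<notin> {0..1}"
  shows "deriv smooth_step t = 0"
proof -
  have "(smooth_step has_real_derivative 0) (at t)"
  proof (cases "t < 0")
    case True
    have "((\<lambda>_. 0) has_real_derivative 0) (at t)" by simp
    then show ?thesis
      by (rule has_field_derivative_transform_within_open[where S="{..<0}"])
        (use True in \<open>auto simp: smooth_step_eq_0\<close>)
  next
    case False
    have "((\<lambda>_. 1) has_real_derivative 0) (at t)" by simp
    then show ?thesis
      by (rule has_field_derivative_transform_within_open[where S="{1<..}"])
        (use False assms in \<open>auto simp: smooth_step_eq_1\<close>)
  qed
  then show ?thesis
    by (rule DERIV_imp_deriv)
qed

lemma deriv_smooth_step_has_integral: "(deriv smooth_step has_integral 1) {0..1}"
proof -
  have "(deriv smooth_step has_integral (smooth_step 1 - smooth_step 0)) {0..1}"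
    by (rule fundamental_theorem_of_calculus)
      (auto intro: smooth_step_deriv DERIV_subset
        simp flip: has_real_derivative_iff_has_vector_derivative)
  then show ?thesis
    by (simp add: smooth_step_eq_0 smooth_step_eq_1)
qed

section \<open>Weak derivatives of continuous functions\<close>

lemma test_functions_deriv:
  assumes "\<phi> \<in> test_functions S"
  shows "deriv \<phi> \<in> test_functions S"
proof -
  from assms obtain K where K: "compact K" "K \<subseteq> S" "\<And>t. t \<notin> K \<Longrightarrow> \<phi> t = 0"
    and sm: "\<And>m t. ((deriv ^^ m) \<phi>) field_differentiable (at t)"
    by (auto simp: test_functions_def)
  have "deriv \<phi> t = 0" if "t \<notin> K" for t
  proof -
    have "((\<lambda>_. 0) has_real_derivative 0) (at t)" by simp
    then have "(\<phi> has_real_derivative 0) (at t)"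
      by (rule has_field_derivative_transform_within_open[where S="- K"])
        (use K that compact_imp_closed in auto)
    then show ?thesis
      by (rule DERIV_imp_deriv)
  qed
  moreover have "((deriv ^^ m) (deriv \<phi>)) field_differentiable (at t)" for m t
    using sm[of "Suc m" t] by (simp add: funpow_swap1)
  ultimately show ?thesis
    using K by (auto simp: test_functions_def)
qed

lemma test_functions_has_deriv:
  assumes "\<phi> \<in> test_functions S"
  shows "(\<phi> has_real_derivative deriv \<phi> t) (at t)"
proof -
  have "((deriv ^^ 0) \<phi>) field_differentiable (at t)"
    using assms unfolding test_functions_def by blast
  then show ?thesis
    by (simp add: DERIV_deriv_iff_field_differentiable)
qed

lemma test_functions_continuous:
  assumes "\<phi> \<in> test_functions S"
  shows "continuous_on T \<phi>"
  using test_functions_has_deriv[OF assms]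
  by (meson DERIV_isCont continuous_at_imp_continuous_on)

lemma test_functions_eq_0: "\<phi> \<in> test_functions S \<Longrightarrow> t \<notin> S \<Longrightarrow> \<phi> t = 0"
  by (auto simp: test_functions_def)

lemma smooth_closure_test_function:
  assumes "f \<in> smooth_closure" "compact K" "K \<subseteq> S" "\<And>t. t \<notin> K \<Longrightarrow> f t = 0"
  shows "f \<in> test_functions S"
  using assms smooth_closure_differentiable unfolding test_functions_def by blast

section \<open>Mollification and the fundamental theorem of calculus for weak derivatives\<close>

lemma continuous_integrable_Omega:
  fixes f :: "real \<Rightarrow> 'a::euclidean_space"
  assumes "continuous_on {-1..1} f"
  shows "integrable (lebesgue_on Omega) f"
proof -
  have "f absolutely_integrable_on {-1..1}"
    using assms by (rule absolutely_integrable_continuous_real)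
  then have "f absolutely_integrable_on Omega"
    using absolutely_integrable_on_open_interval[where f=f and a="-1" and b=1] by simp
  then show ?thesis
    by (rule absolutely_integrable_imp_integrable) simp
qed

text \<open>The substitution t = s + x / (n + 1) turns the integral into one against the fixed
  kernel \<open>deriv smooth_step\<close>, which has support in [0, 1] and mass 1. Dominated
  convergence and continuity of u at s then give the limit.\<close>

lemma approximate_identity_tendsto:
  fixes u :: "real \<Rightarrow> complex"
  assumes u: "continuous_on {-1..1} u" and s: "s \<in> Omega"
  shows "(\<lambda>n. LINT t|lebesgue_on Omega.
      u t * of_real (real (Suc n) * deriv smooth_step (real (Suc n) * (t - s)))) \<longlonglongrightarrow> u s"
proof -
  let ?d = "deriv smooth_step"
  \<comment> \<open>Extension by zero lets the substitution run over the whole real line.\<close>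
  define U where "U = (\<lambda>t. if t \<in> Omega then u t else 0)"
  define F where "F = (\<lambda>n x. U (s + (1 / real (Suc n)) * x) * of_real (?d x))"
  have cu: "continuous_on Omega u"
    using u by (rule continuous_on_subset) auto
  have meas: "U \<in> borel_measurable borel"
    unfolding U_def by (intro borel_measurable_continuous_on_if cu) auto
  obtain C where C: "\<And>t. t \<in> {-1..1} \<Longrightarrow> norm (u t) \<le> C"
    using compact_continuous_image[OF u] compact_imp_bounded bounded_iff
    by (metis compact_Icc imageI)
  have "norm (u 0) \<le> C" using C[of 0] by simp
  then have "C \<ge> 0"
    by (rule order_trans[OF norm_ge_zero])
  have dcut: "?d = (\<lambda>x. if x \<in> {0..1} then ?d x else 0)"
    using deriv_smooth_step_eq_0 by auto
  have dint: "integrable (lebesgue_on {0..1}) ?d"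
    by (rule continuous_imp_integrable_real[OF continuous_on_deriv_smooth_step])
  have dint': "integrable lebesgue ?d"
    by (subst dcut, subst Lebesgue_Measure.integrable_restrict_UNIV) (use dint in auto)
  have "integral\<^sup>L lebesgue ?d = integral\<^sup>L (lebesgue_on {0..1}) ?d"
    by (subst dcut, subst Lebesgue_Measure.integral_restrict_UNIV) auto
  also have "\<dots> = 1"
    using lebesgue_integral_eq_integral[OF dint] deriv_smooth_step_has_integral
    by (auto simp: integral_unique)
  finally have d1: "integral\<^sup>L lebesgue ?d = 1" .
  have eq: "(LINT t|lebesgue_on Omega.
      u t * of_real (real (Suc n) * ?d (real (Suc n) * (t - s)))) = integral\<^sup>L lebesgue (F n)" for n
  proof -
    let ?N = "real (Suc n)"
    define f where "f = (\<lambda>t. if t \<in> Omega then u t * of_real (?N * ?d (?N * (t - s))) else 0)"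
    have "(LINT t|lebesgue_on Omega. u t * of_real (?N * ?d (?N * (t - s)))) = integral\<^sup>L lebesgue f"
      unfolding f_def by (subst Lebesgue_Measure.integral_restrict_UNIV) auto
    also have "\<dots> = \<bar>1 / ?N\<bar> *\<^sub>R (LINT x|lebesgue. f (s + (1 / ?N) * x))"
      by (rule lebesgue_integral_real_affine) simp
    also have "\<dots> = (LINT x|lebesgue. \<bar>1 / ?N\<bar> *\<^sub>R f (s + (1 / ?N) * x))"
      by simp
    also have "(\<lambda>x. \<bar>1 / ?N\<bar> *\<^sub>R f (s + (1 / ?N) * x)) = F n"
      using of_nat_neq_0[of n, where 'a=complex]
      by (auto simp: f_def F_def U_def fun_eq_iff scaleR_conv_of_real)
    finally show ?thesis .
  qed
  have "(\<lambda>n. integral\<^sup>L lebesgue (F n)) \<longlonglongrightarrow> (LINT x|lebesgue. u s * of_real (?d x))"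
  proof (rule integral_dominated_convergence[where w="\<lambda>x. C * norm (?d x)"])
    have dm: "?d \<in> borel_measurable borel"
      by (rule borel_measurable_continuous_onI[OF continuous_on_deriv_smooth_step])
    have "(\<lambda>x. u s * of_real (?d x)) \<in> borel_measurable borel"
      using dm by measurable
    then show "(\<lambda>x. u s * of_real (?d x)) \<in> borel_measurable lebesgue"
      by (simp add: measurable_completion)
    have "F n \<in> borel_measurable borel" for n
      unfolding F_def using dm meas by measurable
    then show "F n \<in> borel_measurable lebesgue" for n
      by (simp add: measurable_completion)
    show "integrable lebesgue (\<lambda>x. C * norm (?d x))"
      using dint' by auto
    show "AE x in lebesgue. norm (F n x) \<le> C * norm (?d x)" for n
      using C \<open>C \<ge> 0\<close> by (intro AE_I2) (auto simp: F_def U_def norm_mult intro!: mult_right_mono)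
    have "(\<lambda>n. F n x) \<longlonglongrightarrow> u s * of_real (?d x)" for x
    proof -
      have "isCont u s"
        using cu s by (simp add: continuous_on_eq_continuous_at)
      moreover have U: "\<forall>\<^sub>F t in nhds s. u t = U t"
        using s eventually_nhds_in_open[of Omega s] by (auto simp: U_def elim!: eventually_mono)
      ultimately have "isCont U s"
        using isCont_cong by blast
      moreover have "(\<lambda>n. s + (1 / real (Suc n)) * x) \<longlonglongrightarrow> s + 0 * x"
        by (intro tendsto_intros lim_1_over_n[THEN LIMSEQ_Suc])
      then have "(\<lambda>n. s + (1 / real (Suc n)) * x) \<longlonglongrightarrow> s"
        by (simp only: mult_zero_left add_0_right)
      ultimately have "(\<lambda>n. U (s + (1 / real (Suc n)) * x)) \<longlonglongrightarrow> U s"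
        by (rule isCont_tendsto_compose)
      then show ?thesis
        unfolding F_def using s by (auto simp: U_def intro!: tendsto_mult_right)
    qed
    then show "AE x in lebesgue. (\<lambda>n. F n x) \<longlonglongrightarrow> u s * of_real (?d x)"
      by simp
  qed
  also have "(LINT x|lebesgue. u s * of_real (?d x)) = u s"
    using d1 by simp
  finally show ?thesis
    unfolding eq .
qed

text \<open>The test function is a smooth plateau that rises just to the right of s and falls just
  to the right of t. Its derivative is a difference of approximate identities at s and t, so one
  side of the weak relation tends to u s - u t; the plateau itself tends to the indicator of the
  interval, so the other side tends to minus the integral of w.\<close>

lemma weak_deriv_has_integral:
  assumes u: "continuous_on {-1..1} u" and w: "has_weak_deriv Omega 1 u w"
    and st: "-1 < s" "s \<le> t" "t < 1"
  shows "(w has_integral (u t - u s)) {s..t}"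
proof -
  let ?d = "deriv smooth_step"
  define N where "N = (\<lambda>n. real (Suc n))"
  define \<phi> where "\<phi> = (\<lambda>n \<tau>. smooth_step (N n * (\<tau> - s)) - smooth_step (N n * (\<tau> - t)))"
  \<comment> \<open>The falling ramp at t extends 1 / \<open>N n\<close> to the right. The midpoint
    \<open>T\<close> between t and 1 leaves room for it, so from index m below onwards all plateaus
    are supported in the one compact set \<open>K\<close> inside \<open>Omega\<close>.\<close>
  define T where "T = (t + 1) / 2"
  define K where "K = {s..T}"
  have K: "compact K" "K \<subseteq> Omega" "K \<in> sets lebesgue"
    using st by (auto simp: K_def T_def)
  have Kw: "integrable (lebesgue_on K) w"
    using w K by (auto simp: has_weak_deriv_def locally_integrable_on_def)
  have Npos: "N n > 0" for n by (simp add: N_def)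
  obtain m where m: "inverse (real (Suc m)) < T - t"
    using reals_Archimedean[of "T - t"] st by (auto simp: T_def)
  have \<phi>0: "\<phi> n \<tau> = 0" if "n \<ge> m" "\<tau> \<notin> K" for n \<tau>
  proof (cases "\<tau> < s")
    case True
    then have "N n * (\<tau> - s) \<le> 0" "N n * (\<tau> - t) \<le> 0"
      using Npos[of n] st by (auto intro!: mult_nonneg_nonpos)
    then show ?thesis
      by (simp add: \<phi>_def smooth_step_eq_0)
  next
    case False
    with that have "\<tau> > T" by (auto simp: K_def)
    have "inverse (N n) \<le> inverse (real (Suc m))"
      using that by (intro le_imp_inverse_le) (auto simp: N_def)
    with m \<open>\<tau> > T\<close> have "inverse (N n) \<le> \<tau> - t"
      by simp
    then have 1: "N n * (\<tau> - t) \<ge> 1"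
      using Npos[of n] by (simp add: field_simps)
    moreover have "N n * (\<tau> - t) \<le> N n * (\<tau> - s)"
      using Npos[of n] st by (intro mult_left_mono) auto
    ultimately show ?thesis
      by (simp add: \<phi>_def smooth_step_eq_1)
  qed
  have \<phi>_deriv: "deriv (\<phi> n) = (\<lambda>\<tau>. N n * ?d (N n * (\<tau> - s)) - N n * ?d (N n * (\<tau> - t)))" for n
  proof
    fix \<tau>
    have 1: "((\<lambda>\<tau>. smooth_step (N n * (\<tau> - a))) has_real_derivative ?d (N n * (\<tau> - a)) * N n) (at \<tau>)" for a
      by (rule DERIV_chain2[OF smooth_step_deriv]) (auto intro!: derivative_eq_intros)
    have "(\<phi> n has_real_derivative (?d (N n * (\<tau> - s)) * N n - ?d (N n * (\<tau> - t)) * N n)) (at \<tau>)"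
      unfolding \<phi>_def by (intro DERIV_diff 1)
    then show "deriv (\<phi> n) \<tau> = N n * ?d (N n * (\<tau> - s)) - N n * ?d (N n * (\<tau> - t))"
      by (simp add: DERIV_imp_deriv mult.commute)
  qed
  have \<phi>_test: "\<phi> n \<in> test_functions Omega" if "n \<ge> m" for n
  proof (rule smooth_closure_test_function[OF _ K(1,2) \<phi>0[OF that]])
    have "\<phi> n = (\<lambda>\<tau>. smooth_step (N n * \<tau> + (- N n * s)) + (-1) * smooth_step (N n * \<tau> + (- N n * t)))"
      by (auto simp: \<phi>_def algebra_simps)
    also have "\<dots> \<in> smooth_closure"
      by (intro smooth_closure.intros smooth_step_affine_smooth)
    finally show "\<phi> n \<in> smooth_closure" .
  qed
  have L: "(\<lambda>n. LINT \<tau>|lebesgue_on Omega. u \<tau> * of_real (deriv (\<phi> n) \<tau>)) \<longlonglongrightarrow> u s - u t"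
  proof -
    have int: "integrable (lebesgue_on Omega) (\<lambda>\<tau>. u \<tau> * of_real (N n * ?d (N n * (\<tau> - a))))" for n a
      by (rule continuous_integrable_Omega)
        (intro continuous_intros u continuous_on_compose2[OF continuous_on_deriv_smooth_step[of UNIV]]; simp)
    have "(LINT \<tau>|lebesgue_on Omega. u \<tau> * of_real (deriv (\<phi> n) \<tau>)) =
        (LINT \<tau>|lebesgue_on Omega. u \<tau> * of_real (N n * ?d (N n * (\<tau> - s))))
        - (LINT \<tau>|lebesgue_on Omega. u \<tau> * of_real (N n * ?d (N n * (\<tau> - t))))" for n
      unfolding Bochner_Integration.integral_diff[OF int int, symmetric] \<phi>_deriv
      by (intro Bochner_Integration.integral_cong) (auto simp: algebra_simps)
    then show ?thesis
      using tendsto_diff[OF approximate_identity_tendsto[OF u, of s] approximate_identity_tendsto[OF u, of t]] st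
      by (simp add: N_def)
  qed
  \<comment> \<open>Each ramp starts at its base point with value 0, so the pointwise limit is the
    indicator of the half-open interval. The plateaus are bounded by 1, hence |w| dominates.\<close>
  have R: "(\<lambda>n. LINT \<tau>|lebesgue_on K. w \<tau> * of_real (\<phi> n \<tau>))
      \<longlonglongrightarrow> (LINT \<tau>|lebesgue_on K. (if \<tau> \<in> {s<..t} then w \<tau> else 0))"
  proof (rule integral_dominated_convergence[where w="\<lambda>\<tau>. norm (w \<tau>)"])
    have wm: "w \<in> borel_measurable (lebesgue_on K)"
      using Kw by auto
    have "{s<..t} \<inter> K \<in> sets (lebesgue_on K)"
      using K by (auto simp: sets_restrict_space_iff intro!: sets.Int)
    then show "(\<lambda>\<tau>. if \<tau> \<in> {s<..t} then w \<tau> else 0) \<in> borel_measurable (lebesgue_on K)"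
      using wm by (intro measurable_If_set) auto
    have "continuous_on UNIV smooth_step"
      using smooth_step_deriv by (blast intro: DERIV_continuous_on has_field_derivative_at_within)
    then have "smooth_step \<in> borel_measurable borel"
      by (rule borel_measurable_continuous_onI)
    then have "\<phi> n \<in> borel_measurable borel" for n
      unfolding \<phi>_def by measurable
    then have "\<phi> n \<in> borel_measurable (lebesgue_on K)" for n
      by (simp add: measurable_completion measurable_restrict_space1)
    then show "(\<lambda>\<tau>. w \<tau> * of_real (\<phi> n \<tau>)) \<in> borel_measurable (lebesgue_on K)" for n
      using wm by measurable
    show "integrable (lebesgue_on K) (\<lambda>\<tau>. norm (w \<tau>))"
      using Kw by auto
    have "\<bar>\<phi> n \<tau>\<bar> \<le> 1" for n \<tau>
      using smooth_step_bounds[of "N n * (\<tau> - s)"] smooth_step_bounds[of "N n * (\<tau> - t)"]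
      by (auto simp: \<phi>_def)
    then show "AE \<tau> in lebesgue_on K. norm (w \<tau> * of_real (\<phi> n \<tau>)) \<le> norm (w \<tau>)" for n
      by (simp add: norm_mult mult_left_le)
    have step: "(\<lambda>n. smooth_step (N n * (\<tau> - a))) \<longlonglongrightarrow> (if \<tau> > a then 1 else 0)" for \<tau> a
    proof (cases "\<tau> > a")
      case True
      have "LIM n sequentially. N n :> at_top"
        unfolding N_def
        by (rule filterlim_compose[OF filterlim_real_sequentially filterlim_Suc])
      then have "LIM n sequentially. N n * (\<tau> - a) :> at_top"
        using True by (intro filterlim_at_top_mult_tendsto_pos[OF tendsto_const]) auto
      then have "\<forall>\<^sub>F n in sequentially. N n * (\<tau> - a) \<ge> 1"
        by (auto simp: filterlim_at_top)
      then have "\<forall>\<^sub>F n in sequentially. 1 = smooth_step (N n * (\<tau> - a))"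
        by eventually_elim (simp add: smooth_step_eq_1)
      with True show ?thesis
        by (auto intro: Lim_transform_eventually[OF tendsto_const])
    next
      case False
      then have "smooth_step (N n * (\<tau> - a)) = 0" for n
        using Npos[of n] by (intro smooth_step_eq_0) (auto intro!: mult_nonneg_nonpos)
      with False show ?thesis by simp
    qed
    have "(\<lambda>n. w \<tau> * of_real (\<phi> n \<tau>)) \<longlonglongrightarrow> (if \<tau> \<in> {s<..t} then w \<tau> else 0)" for \<tau>
    proof -
      have "(\<lambda>n. w \<tau> * of_real (\<phi> n \<tau>)) \<longlonglongrightarrow>
          w \<tau> * of_real ((if \<tau> > s then 1 else 0) - (if \<tau> > t then 1 else 0))"
        unfolding \<phi>_def by (intro tendsto_intros step)
      moreover have "w \<tau> * of_real ((if \<tau> > s then 1 else 0) - (if \<tau> > t then 1 else 0)) =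
          (if \<tau> \<in> {s<..t} then w \<tau> else 0)"
        using st by auto
      ultimately show ?thesis by simp
    qed
    then show "AE \<tau> in lebesgue_on K. (\<lambda>n. w \<tau> * of_real (\<phi> n \<tau>)) \<longlonglongrightarrow> (if \<tau> \<in> {s<..t} then w \<tau> else 0)"
      by simp
  qed
  have "\<forall>\<^sub>F n in sequentially. (LINT \<tau>|lebesgue_on Omega. u \<tau> * of_real (deriv (\<phi> n) \<tau>)) =
      - (LINT \<tau>|lebesgue_on K. w \<tau> * of_real (\<phi> n \<tau>))"
  proof (rule eventually_sequentiallyI[of m])
    fix n assume n: "m \<le> n"
    have "(LINT \<tau>|lebesgue_on Omega. u \<tau> * of_real (deriv (\<phi> n) \<tau>)) =
        - (LINT \<tau>|lebesgue_on Omega. w \<tau> * of_real (\<phi> n \<tau>))"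
      using w \<phi>_test[OF n] by (auto simp: has_weak_deriv_def)
    also have "(LINT \<tau>|lebesgue_on Omega. w \<tau> * of_real (\<phi> n \<tau>)) =
        (LINT \<tau>|lebesgue_on Omega. (if \<tau> \<in> K then w \<tau> * of_real (\<phi> n \<tau>) else 0))"
      using \<phi>0[OF n] by (intro Bochner_Integration.integral_cong) auto
    also have "\<dots> = (LINT \<tau>|lebesgue_on K. w \<tau> * of_real (\<phi> n \<tau>))"
      by (rule Lebesgue_Measure.integral_restrict) (use K in auto)
    finally show "(LINT \<tau>|lebesgue_on Omega. u \<tau> * of_real (deriv (\<phi> n) \<tau>)) =
      - (LINT \<tau>|lebesgue_on K. w \<tau> * of_real (\<phi> n \<tau>))" .
  qed
  with L have "(\<lambda>n. - (LINT \<tau>|lebesgue_on K. w \<tau> * of_real (\<phi> n \<tau>))) \<longlonglongrightarrow> u s - u t"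
    by (rule Lim_transform_eventually)
  from LIMSEQ_unique[OF tendsto_minus[OF this]] R
  have I: "(LINT \<tau>|lebesgue_on K. (if \<tau> \<in> {s<..t} then w \<tau> else 0)) = u t - u s"
    by auto
  have sub: "{s<..t} \<subseteq> K" "{s<..t} \<inter> K \<in> sets (lebesgue_on K)"
    using K st by (auto simp: sets_restrict_space_iff K_def T_def intro!: sets.Int)
  have "integrable (lebesgue_on K) (\<lambda>\<tau>. if \<tau> \<in> {s<..t} then w \<tau> else 0)"
    using integrable_mult_indicator[OF sub(2) Kw]
    by (rule Bochner_Integration.integrable_cong[THEN iffD1, rotated -1]) (use sub in \<open>auto simp: indicator_def\<close>)
  from has_integral_integral_lebesgue_on[OF this K(3)]
  have "((\<lambda>\<tau>. if \<tau> \<in> {s<..t} then w \<tau> else 0) has_integral (u t - u s)) K"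
    by (simp only: I)
  then have *: "(w has_integral (u t - u s)) {s<..t}"
    by (simp only: has_integral_restrict[OF sub(1)])
  show ?thesis
  proof (rule has_integral_spike_set_eq[THEN iffD1, OF _ _ *])
    show "negligible {x \<in> {s<..t} - {s..t}. w x \<noteq> 0}"
      by (rule negligible_subset[of "{s}"]) auto
    show "negligible {x \<in> {s..t} - {s<..t}. w x \<noteq> 0}"
      by (rule negligible_subset[of "{s}"]) auto
  qed
qed

section \<open>Uniqueness of first weak derivatives\<close>

text \<open>By Henstock's lemma, the Riemann sums of \<open>norm f\<close> over fine tagged divisions are small, since
  every term \<open>integral k f\<close> vanishes; hence \<open>norm f\<close> integrates to 0.\<close>
lemma negligible_nonzero_if_interval_integrals_0:
  fixes f :: "real \<Rightarrow> complex"
  assumes 0: "\<And>s t. a \<le> s \<Longrightarrow> s \<le> t \<Longrightarrow> t \<le> b \<Longrightarrow> (f has_integral 0) {s..t}"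
  shows "negligible {t \<in> {a..b}. f t \<noteq> 0}"
proof (cases "a \<le> b")
  case True
  have "((\<lambda>t. norm (f t)) has_integral 0) (cbox a b)"
    unfolding has_integral
  proof (intro allI impI)
    fix e :: real assume "e > 0"
    have "f integrable_on cbox a b"
      using has_integral_integrable[OF 0[of a b]] True by simp
    note ef = \<open>e > 0\<close> this
    obtain \<gamma> where \<gamma>: "gauge \<gamma>" and H: "\<And>p. p tagged_partial_division_of cbox a b \<Longrightarrow> \<gamma> fine p \<Longrightarrow>
        (\<Sum>(x, k)\<in>p. norm (measure lborel k *\<^sub>R f x - integral k f)) < e"
      by (rule Henstock_lemma[OF ef(2,1)]) (rule that)
    have "norm ((\<Sum>(x, k)\<in>p. measure lborel k *\<^sub>R norm (f x)) - 0) < e"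
      if p: "p tagged_division_of cbox a b" "\<gamma> fine p" for p
    proof -
      have eq: "measure lborel k *\<^sub>R norm (f x) = norm (measure lborel k *\<^sub>R f x - integral k f)"
        if xk: "(x, k) \<in> p" for x k
      proof -
        obtain s t where k: "k = cbox s t"
          using tagged_division_ofD(4)[OF p(1) xk] by blast
        have "x \<in> cbox s t" "cbox s t \<subseteq> cbox a b"
          using tagged_division_ofD(2,3)[OF p(1) xk] k by simp_all
        then have st: "a \<le> s" "s \<le> t" "t \<le> b"
          by (simp_all add: box_real(2))
        have "integral k f = 0"
          unfolding k box_real(2) by (rule integral_unique[OF 0[OF st]])
        then show ?thesis
          by simp
      qed
      have "(\<Sum>(x, k)\<in>p. measure lborel k *\<^sub>R norm (f x)) =
          (\<Sum>(x, k)\<in>p. norm (measure lborel k *\<^sub>R f x - integral k f))"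
        by (rule sum.cong[OF refl]) (simp only: case_prod_beta eq prod.collapse)
      moreover have "\<dots> < e"
        by (rule H[OF p(1)[unfolded tagged_division_of_def, THEN conjunct1] p(2)])
      moreover have "(\<Sum>(x, k)\<in>p. norm (measure lborel k *\<^sub>R f x - integral k f)) \<ge> 0"
        by (intro sum_nonneg) auto
      ultimately show ?thesis
        by simp
    qed
    then show "\<exists>\<gamma>. gauge \<gamma> \<and> (\<forall>\<D>. \<D> tagged_division_of cbox a b \<and> \<gamma> fine \<D> \<longrightarrow>
        norm ((\<Sum>(x, k)\<in>\<D>. measure lborel k *\<^sub>R norm (f x)) - 0) < e)"
      by (intro exI[of _ \<gamma>] conjI \<gamma> allI impI) (elim conjE)
  qed
  then have N: "((\<lambda>t. norm (f t)) has_integral 0) {a..b}"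
    by (simp only: box_real(2))
  have "(\<lambda>t. norm (f t)) absolutely_integrable_on {a..b}"
    by (rule nonnegative_absolutely_integrable_1[OF has_integral_integrable[OF N]]) simp
  then have L: "integrable (lebesgue_on {a..b}) (\<lambda>t. norm (f t))"
    by (rule absolutely_integrable_imp_integrable) simp
  have "integral\<^sup>L (lebesgue_on {a..b}) (\<lambda>t. norm (f t)) = 0"
    using lebesgue_integral_eq_integral[OF L] integral_unique[OF N] by simp
  then have "AE t in lebesgue_on {a..b}. f t = 0"
    by (simp add: integral_nonneg_eq_0_iff_AE[OF L])
  then have "AE t in lebesgue. t \<in> {a..b} \<longrightarrow> f t = 0"
    by (simp add: AE_restrict_space_iff)
  then obtain N where N: "{t \<in> space lebesgue. \<not> (t \<in> {a..b} \<longrightarrow> f t = 0)} \<subseteq> N"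
    "emeasure lebesgue N = 0" "N \<in> sets lebesgue"
    by (rule AE_E)
  have "negligible N"
    using N(2,3) by (simp add: negligible_iff_null_sets null_setsI)
  then show ?thesis
    by (rule negligible_subset) (use N(1) in auto)
next
  case False
  then have "{t \<in> {a..b}. f t \<noteq> 0} = {}"
    by auto
  then show ?thesis
    by (simp only: negligible_empty)
qed

text \<open>Both candidates have the same integral over every closed subinterval of
  \<open>Omega\<close>. The preceding lemma therefore applies to their difference on each interval
  of a countable exhaustion, and a countable union of negligible sets is negligible.\<close>

lemma weak_deriv_unique:
  assumes u: "continuous_on {-1..1} u"
    and w: "has_weak_deriv Omega 1 u w" "has_weak_deriv Omega 1 u w'"
  shows "AE t in lebesgue_on Omega. w t = w' t"
proof -
  define r where "r = (\<lambda>n. inverse (real (Suc n)))"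
  have r: "r n > 0" for n by (simp add: r_def)
  have neg: "negligible {t \<in> {-1 + r n..1 - r n}. w t - w' t \<noteq> 0}" for n
  proof (rule negligible_nonzero_if_interval_integrals_0)
    fix s t assume "-1 + r n \<le> s" "s \<le> t" "t \<le> 1 - r n"
    with r[of n] have "-1 < s" "s \<le> t" "t < 1" by auto
    from has_integral_diff[OF weak_deriv_has_integral[OF u w(1) this] weak_deriv_has_integral[OF u w(2) this]]
    show "((\<lambda>t. w t - w' t) has_integral 0) {s..t}"
      by simp
  qed
  have cover: "\<exists>n. t \<in> {-1 + r n..1 - r n}" if "t \<in> Omega" for t
  proof -
    have "min (1 - t) (t + 1) > 0"
      using that by simp
    then obtain n where "r n < min (1 - t) (t + 1)"
      unfolding r_def using reals_Archimedean by blast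
    then show ?thesis
      by (intro exI[of _ n]) auto
  qed
  define Z where "Z = (\<Union>n. {t \<in> {-1 + r n..1 - r n}. w t - w' t \<noteq> 0})"
  have "negligible Z"
    unfolding Z_def using neg by (intro negligible_countable_Union) auto
  then have "Z \<in> null_sets lebesgue"
    by (simp add: negligible_iff_null_sets)
  moreover have "t \<in> Z" if "t \<in> Omega" "w t \<noteq> w' t" for t
    using cover[OF that(1)] that(2) by (auto simp: Z_def)
  then have "{t \<in> space lebesgue. \<not> (t \<in> Omega \<longrightarrow> w t = w' t)} \<subseteq> Z"
    by blast
  ultimately have "AE t in lebesgue. t \<in> Omega \<longrightarrow> w t = w' t"
    by (rule AE_I')
  then show ?thesis
    by (simp add: AE_restrict_space_iff)
qed

section \<open>Square-integrable functions and weak derivatives on the interval\<close>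

text \<open>This is completeness of Lebesgue measure. It carries measurability from an explicit
  derivative over to the arbitrary representative \<open>weak_deriv\<close>.\<close>

lemma lebesgue_on_measurable_AE:
  fixes f g :: "real \<Rightarrow> complex"
  assumes S: "S \<in> sets lebesgue" and f: "f \<in> borel_measurable (lebesgue_on S)"
    and ae: "AE t in lebesgue_on S. f t = g t"
  shows "g \<in> borel_measurable (lebesgue_on S)"
proof -
  have "(\<lambda>t. if t \<in> S then f t else 0) \<in> borel_measurable lebesgue"
    using borel_measurable_if[OF S] f by blast
  moreover have "AE t in lebesgue. (if t \<in> S then f t else 0) = (if t \<in> S then g t else 0)"
    using ae S by (simp add: AE_restrict_space_iff)
  ultimately have "(\<lambda>t. if t \<in> S then g t else 0) \<in> borel_measurable lebesgue"
    by (rule borel_measurable_AE)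
  then show ?thesis
    using borel_measurable_if[OF S] by blast
qed

lemma lebesgue_on_integral_cong_AE:
  fixes f g :: "real \<Rightarrow> complex"
  assumes "S \<in> sets lebesgue" "f \<in> borel_measurable (lebesgue_on S)"
    and "AE t in lebesgue_on S. f t = g t"
  shows "integral\<^sup>L (lebesgue_on S) g = integral\<^sup>L (lebesgue_on S) f"
  by (rule integral_cong_AE[OF lebesgue_on_measurable_AE[OF assms] assms(2)])
    (use assms(3) in \<open>auto elim: eventually_mono\<close>)

lemma AE_lebesgue_on_finite:
  assumes "finite F" "S \<in> sets lebesgue"
  shows "AE t::real in lebesgue_on S. t \<notin> F"
proof -
  have "F \<in> null_sets lebesgue"
    using assms(1) by (simp add: negligible_finite flip: negligible_iff_null_sets)
  then have "AE t in lebesgue. t \<notin> F"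
    by (rule AE_not_in)
  then show ?thesis
    using assms(2) by (simp add: AE_restrict_space_iff) (auto elim: eventually_mono)
qed

section \<open>Integrability and norms on the bounded interval\<close>

lemma finite_measure_Omega: "finite_measure (lebesgue_on Omega)"
  by (rule finite_measure_lebesgue_on) simp

lemma bounded_integrable_Omega:
  fixes f :: "real \<Rightarrow> 'a::euclidean_space"
  assumes "f \<in> borel_measurable (lebesgue_on Omega)" "\<And>t. t \<in> Omega \<Longrightarrow> norm (f t) \<le> C"
  shows "integrable (lebesgue_on Omega) f"
  by (rule finite_measure.integrable_const_bound[OF finite_measure_Omega, of _ C])
    (use assms in \<open>auto intro: AE_I2\<close>)

lemma integrable_Omega_subset:
  fixes f :: "real \<Rightarrow> 'a::euclidean_space"
  assumes f: "integrable (lebesgue_on Omega) f" and K: "K \<in> sets lebesgue" "K \<subseteq> Omega"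
  shows "integrable (lebesgue_on K) f"
proof -
  have "integrable lebesgue (\<lambda>t. if t \<in> Omega then f t else 0)"
    using f by (subst Lebesgue_Measure.integrable_restrict_UNIV) auto
  from integrable_mult_indicator[OF K(1) this]
  have "integrable lebesgue (\<lambda>t. indicator K t *\<^sub>R (if t \<in> Omega then f t else 0))" .
  also have "(\<lambda>t. indicator K t *\<^sub>R (if t \<in> Omega then f t else 0)) = (\<lambda>t. if t \<in> K then f t else 0)"
    using K(2) by (auto simp: indicator_def fun_eq_iff)
  finally show ?thesis
    using Lebesgue_Measure.integrable_restrict_UNIV[OF K(1), of f] by simp
qed

lemma integrable_imp_locally_integrable_Omega:
  "integrable (lebesgue_on Omega) f \<Longrightarrow> f locally_integrable_on Omega"
  by (auto simp: locally_integrable_on_def intro!: integrable_Omega_subset lmeasurable_compact fmeasurableD)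

lemma square_integrable_imp_integrable_Omega:
  assumes "f square_integrable_on Omega"
  shows "integrable (lebesgue_on Omega) f"
proof (rule Bochner_Integration.integrable_bound)
  interpret finite_measure "lebesgue_on Omega"
    by (rule finite_measure_Omega)
  show "integrable (lebesgue_on Omega) (\<lambda>t. 1 + (cmod (f t))\<^sup>2)"
    using assms by (auto simp: square_integrable_on_def)
  show "f \<in> borel_measurable (lebesgue_on Omega)"
    using assms by (auto simp: square_integrable_on_def)
  have "a \<le> 1 + a\<^sup>2" for a :: real
    using zero_le_power2[of "a - 1/2"] by (simp add: power2_eq_square algebra_simps)
  then show "AE t in lebesgue_on Omega. norm (f t) \<le> norm (1 + (cmod (f t))\<^sup>2)"
    by (simp add: abs_of_nonneg)
qed

lemma bounded_square_integrable_Omega: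
  assumes "f \<in> borel_measurable (lebesgue_on Omega)" "\<And>t. t \<in> Omega \<Longrightarrow> cmod (f t) \<le> C"
  shows "f square_integrable_on Omega"
proof -
  have "integrable (lebesgue_on Omega) (\<lambda>t. (cmod (f t))\<^sup>2)"
    by (rule bounded_integrable_Omega[where C="C\<^sup>2"]) (use assms in \<open>auto intro: power_mono\<close>)
  with assms(1) show ?thesis
    by (simp add: square_integrable_on_def)
qed

text \<open>The factor is the square root of the length of \<open>Omega\<close>. The pointwise bound
  is asked of f only, because the function g to be estimated will be \<open>weak_deriv\<close>,
  known only almost everywhere.\<close>

lemma L2_norm_Omega_le:
  assumes f: "f \<in> borel_measurable (lebesgue_on Omega)"
    and D: "\<And>t. t \<in> Omega \<Longrightarrow> cmod (f t) \<le> D" and ae: "AE t in lebesgue_on Omega. f t = g t"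
  shows "L2_norm_on Omega g \<le> sqrt 2 * D"
proof -
  interpret finite_measure "lebesgue_on Omega"
    by (rule finite_measure_Omega)
  have "cmod (f 0) \<le> D"
    using D[of 0] by simp
  then have "D \<ge> 0"
    by (rule order_trans[OF norm_ge_zero])
  have g: "g \<in> borel_measurable (lebesgue_on Omega)"
    using lebesgue_on_measurable_AE[OF _ f ae] by simp
  have "(LINT t|lebesgue_on Omega. (cmod (g t))\<^sup>2) = (LINT t|lebesgue_on Omega. (cmod (f t))\<^sup>2)"
    by (rule integral_cong_AE) (use f g ae in \<open>auto elim: eventually_mono\<close>)
  also have "\<dots> \<le> (LINT t|lebesgue_on Omega. D\<^sup>2)"
    by (rule integral_mono)
      (use bounded_square_integrable_Omega[OF f D] D in
        \<open>auto simp: square_integrable_on_def intro!: power_mono\<close>)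
  also have "\<dots> = 2 * D\<^sup>2"
    by (simp add: measure_restrict_space)
  finally show ?thesis
    using \<open>D \<ge> 0\<close> unfolding L2_norm_on_def
    by (metis real_sqrt_le_mono real_sqrt_mult real_sqrt_abs abs_of_nonneg)
qed

lemma continuous_measurable_Omega:
  fixes f :: "real \<Rightarrow> complex"
  shows "continuous_on {-1..1} f \<Longrightarrow> f \<in> borel_measurable (lebesgue_on Omega)"
  by (rule borel_measurable_integrable[OF continuous_integrable_Omega])

lemma continuous_bounded_Omega:
  fixes f :: "real \<Rightarrow> complex"
  assumes "continuous_on {-1..1} f"
  obtains C where "\<And>t. t \<in> Omega \<Longrightarrow> cmod (f t) \<le> C"
proof -
  have "bounded (f ` {-1..1})"
    using assms by (intro compact_imp_bounded compact_continuous_image) auto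
  then obtain C where "\<forall>y\<in>f ` {-1..1}. norm y \<le> C"
    by (auto simp: bounded_iff)
  then show ?thesis
    by (intro that[of C]) auto
qed

lemma continuous_square_integrable_Omega:
  assumes "continuous_on {-1..1} f"
  shows "f square_integrable_on Omega"
  using continuous_bounded_Omega[OF assms] continuous_measurable_Omega[OF assms]
  by (metis bounded_square_integrable_Omega)

text \<open>Integration by parts: the fundamental theorem with finitely many exceptional points
  applies to the continuous function v \<phi>, and the boundary terms vanish since \<phi> is 0 at -1
  and 1.\<close>

lemma piecewise_C1_has_weak_deriv:
  assumes v: "continuous_on {-1..1} v" and S: "finite S"
    and deriv: "\<And>t. t \<in> Omega - S \<Longrightarrow> (v has_vector_derivative \<psi> t) (at t)"
    and \<psi>: "\<psi> \<in> borel_measurable (lebesgue_on Omega)" "\<And>t. t \<in> Omega \<Longrightarrow> cmod (\<psi> t) \<le> C"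
  shows "has_weak_deriv Omega 1 v \<psi>"
proof -
  have vi: "integrable (lebesgue_on Omega) v"
    by (rule continuous_integrable_Omega[OF v])
  have \<psi>i: "integrable (lebesgue_on Omega) \<psi>"
    by (rule bounded_integrable_Omega[OF \<psi>])
  have "(LINT t|lebesgue_on Omega. v t * of_real (deriv \<phi> t)) =
      - (LINT t|lebesgue_on Omega. \<psi> t * of_real (\<phi> t))" if \<phi>: "\<phi> \<in> test_functions Omega" for \<phi>
  proof -
    let ?F = "\<lambda>t. v t * of_real (deriv \<phi> t) + \<psi> t * of_real (\<phi> t)"
    have c: "continuous_on T \<phi>" "continuous_on T (deriv \<phi>)" for T
      using test_functions_continuous \<phi> test_functions_deriv by blast+
    have i1: "integrable (lebesgue_on Omega) (\<lambda>t. v t * of_real (deriv \<phi> t))"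
      by (intro continuous_integrable_Omega continuous_intros v c)
    obtain B where B: "\<And>t. t \<in> Omega \<Longrightarrow> cmod (of_real (\<phi> t)) \<le> B"
      using continuous_bounded_Omega[OF continuous_on_of_real[OF c(1)]] by blast
    have "cmod (of_real (\<phi> 0)) \<le> B"
      by (rule B) simp
    then have "B \<ge> 0"
      by (rule order_trans[OF norm_ge_zero])
    have i2: "integrable (lebesgue_on Omega) (\<lambda>t. \<psi> t * of_real (\<phi> t))"
    proof (rule bounded_integrable_Omega)
      show "(\<lambda>t. \<psi> t * of_real (\<phi> t)) \<in> borel_measurable (lebesgue_on Omega)"
        using \<psi>(1) continuous_measurable_Omega[OF continuous_on_of_real[OF c(1)]] by measurable
      show "norm (\<psi> t * of_real (\<phi> t)) \<le> C * B" if "t \<in> Omega" for t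
        unfolding norm_mult by (intro mult_mono' \<psi> B that norm_ge_zero)
    qed
    have "(?F has_integral (v 1 * of_real (\<phi> 1) - v (-1) * of_real (\<phi> (-1)))) {-1..1}"
    proof (rule fundamental_theorem_of_calculus_interior_strong[OF S])
      show "((\<lambda>t. v t * of_real (\<phi> t)) has_vector_derivative ?F t) (at t)" if "t \<in> {-1<..<1} - S" for t
      proof (rule has_vector_derivative_mult)
        show "(v has_vector_derivative \<psi> t) (at t)"
          using deriv that by simp
        show "((\<lambda>t. of_real (\<phi> t)) has_vector_derivative of_real (deriv \<phi> t)) (at t)"
          using test_functions_has_deriv[OF \<phi>, of t]
          by (intro has_vector_derivative_of_real) (simp add: has_real_derivative_iff_has_vector_derivative)
      qed
    qed (simp, intro continuous_intros v c)
    then have "(?F has_integral 0) {-1..1}"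
      using test_functions_eq_0[OF \<phi>] by simp
    then have "integral Omega ?F = 0"
      using integral_open_interval_real[of "-1" 1 ?F] by (simp only: integral_unique)
    then have "integral\<^sup>L (lebesgue_on Omega) ?F = 0"
      using lebesgue_integral_eq_integral[OF Bochner_Integration.integrable_add[OF i1 i2]] by simp
    then show ?thesis
      unfolding Bochner_Integration.integral_add[OF i1 i2] by (simp add: eq_neg_iff_add_eq_0)
  qed
  then show ?thesis
    using vi \<psi>i integrable_imp_locally_integrable_Omega by (auto simp: has_weak_deriv_def)
qed

section \<open>The chosen weak derivative agrees almost everywhere with any explicit one\<close>

lemma has_weak_deriv_weak_deriv:
  "has_weak_deriv S k u w \<Longrightarrow> has_weak_deriv S k u (weak_deriv S k u)"
  unfolding weak_deriv_def by (rule someI[of "has_weak_deriv S k u"])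

text \<open>The test function is bounded and supported in a compact subset of \<open>Omega\<close>,
  where w is integrable. This is what allows the pairing with a difference of weak derivatives to be
  split.\<close>

lemma locally_integrable_mult_test_function:
  assumes w: "w locally_integrable_on Omega" and \<phi>: "\<phi> \<in> test_functions Omega"
  shows "integrable (lebesgue_on Omega) (\<lambda>t. w t * of_real (\<phi> t))"
proof -
  obtain K where K: "compact K" "K \<subseteq> Omega" "\<And>t. t \<notin> K \<Longrightarrow> \<phi> t = 0"
    using \<phi> by (auto simp: test_functions_def)
  have Ks: "K \<in> sets lebesgue"
    using K(1) by (intro fmeasurableD lmeasurable_compact)
  have wK: "integrable (lebesgue_on K) w"
    using w K by (auto simp: locally_integrable_on_def)
  have c: "continuous_on {-1..1} (\<lambda>t. of_real (\<phi> t) :: complex)"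
    by (intro continuous_intros test_functions_continuous[OF \<phi>])
  obtain C where C: "\<And>t. t \<in> Omega \<Longrightarrow> cmod (of_real (\<phi> t)) \<le> C"
    using continuous_bounded_Omega[OF c] by blast
  have "continuous_on UNIV (\<lambda>t. of_real (\<phi> t) :: complex)"
    by (intro continuous_intros test_functions_continuous[OF \<phi>])
  then have "(\<lambda>t. of_real (\<phi> t) :: complex) \<in> borel_measurable borel"
    by (rule borel_measurable_continuous_onI)
  then have \<phi>m: "(\<lambda>t. of_real (\<phi> t) :: complex) \<in> borel_measurable (lebesgue_on K)"
    by (simp add: measurable_completion measurable_restrict_space1)
  have "integrable (lebesgue_on K) (\<lambda>t. w t * of_real (\<phi> t))"
  proof (rule measurable_bounded_by_integrable_imp_lebesgue_integrable[OF _ _ _ Ks])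
    show "(\<lambda>t. w t * of_real (\<phi> t)) \<in> borel_measurable (lebesgue_on K)"
      using wK \<phi>m by measurable
    show "integrable (lebesgue_on K) (\<lambda>t. norm (w t) * C)"
      using wK by simp
    show "norm (w t * of_real (\<phi> t)) \<le> norm (w t) * C" if "t \<in> K" for t
      unfolding norm_mult by (intro mult_left_mono C) (use that K in auto)
  qed
  then have "integrable lebesgue (\<lambda>t. if t \<in> K then w t * of_real (\<phi> t) else 0)"
    by (simp only: Lebesgue_Measure.integrable_restrict_UNIV[OF Ks])
  also have "(\<lambda>t. if t \<in> K then w t * of_real (\<phi> t) else 0) =
      (\<lambda>t. if t \<in> Omega then w t * of_real (\<phi> t) else 0)"
    using K(2,3) by (auto simp: fun_eq_iff)
  finally show ?thesis
    using Lebesgue_Measure.integrable_restrict_UNIV[of Omega "\<lambda>t. w t * of_real (\<phi> t)"] by simp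
qed

text \<open>The difference of two weak derivatives of any order is a weak derivative of the zero function,
  which is continuous.\<close>
lemma weak_deriv_unique_AE:
  assumes w: "has_weak_deriv Omega k u w" "has_weak_deriv Omega k u w'"
  shows "AE t in lebesgue_on Omega. w t = w' t"
proof -
  have l: "w locally_integrable_on Omega" "w' locally_integrable_on Omega"
    using w by (auto simp: has_weak_deriv_def)
  have d: "(\<lambda>t. w t - w' t) locally_integrable_on Omega"
    using l by (auto simp: locally_integrable_on_def)
  have "(LINT t|lebesgue_on Omega. (w t - w' t) * of_real (\<phi> t)) = 0" if \<phi>: "\<phi> \<in> test_functions Omega" for \<phi>
  proof -
    note i = locally_integrable_mult_test_function[OF l(1) \<phi>] locally_integrable_mult_test_function[OF l(2) \<phi>]
    have "(-1) ^ k * (LINT t|lebesgue_on Omega. w t * of_real (\<phi> t)) =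
        (-1) ^ k * (LINT t|lebesgue_on Omega. w' t * of_real (\<phi> t))"
      using w \<phi> by (simp add: has_weak_deriv_def)
    then show ?thesis
      by (simp add: left_diff_distrib Bochner_Integration.integral_diff[OF i])
  qed
  then have "has_weak_deriv Omega 1 (\<lambda>_. 0) (\<lambda>t. w t - w' t)"
    using d by (simp add: has_weak_deriv_def) (simp add: locally_integrable_on_def)
  moreover have "has_weak_deriv Omega 1 (\<lambda>_. 0) (\<lambda>_. 0)"
    by (simp add: has_weak_deriv_def locally_integrable_on_def)
  ultimately have "AE t in lebesgue_on Omega. w t - w' t = 0"
    by (intro weak_deriv_unique[of "\<lambda>_. 0"]) auto
  then show ?thesis
    by simp
qed

lemma weak_deriv_AE_eq:
  assumes "has_weak_deriv Omega k u w"
  shows "AE t in lebesgue_on Omega. w t = weak_deriv Omega k u t"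
  using weak_deriv_unique_AE[OF assms has_weak_deriv_weak_deriv[OF assms]] .

lemma piecewise_C1_in_H1:
  assumes v: "continuous_on {-1..1} v" and S: "finite S"
    and deriv: "\<And>t. t \<in> Omega - S \<Longrightarrow> (v has_vector_derivative \<psi> t) (at t)"
    and \<psi>: "\<psi> \<in> borel_measurable (lebesgue_on Omega)" "\<And>t. t \<in> Omega \<Longrightarrow> cmod (\<psi> t) \<le> C"
  shows "v \<in> H1_Omega"
  using piecewise_C1_has_weak_deriv[OF assms] bounded_square_integrable_Omega[OF \<psi>]
    continuous_square_integrable_Omega[OF v] v
  by (auto simp: H1_Omega_def sobolev_def)

text \<open>The difference between the indefinite integral of w and u is constant on [s, 1) by the
  interior version. Global integrability of w makes it continuous up to 1, so the constant persists
  there.\<close>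

lemma weak_deriv_has_integral_closed:
  assumes u: "continuous_on {-1..1} u" and w: "has_weak_deriv Omega 1 u w"
    and wi: "integrable (lebesgue_on Omega) w" and s: "-1 < s" "s < 1"
  shows "integral {s..1} w = u 1 - u s"
proof -
  have "w integrable_on {-1..1}"
    using integrable_on_lebesgue_on[OF wi] by (simp add: integrable_on_open_interval_real)
  then have wi': "w integrable_on {s..1}"
    by (rule integrable_on_subinterval) (use s in auto)
  have cl: "closure {s..<1} = {s..1}"
    using s by simp
  have c1: "continuous_on (closure {s..<1}) (\<lambda>t. integral {s..t} w - u t)"
    unfolding cl
    using s by (intro continuous_intros indefinite_integral_continuous_1 wi' continuous_on_subset[OF u]) auto
  have c2: "integral {s..t} w - u t = - u s" if "t \<in> {s..<1}" for t
    using integral_unique[OF weak_deriv_has_integral[OF u w s(1), of t]] that by simp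
  have "1 \<in> closure {s..<1}"
    using s cl by simp
  from continuous_constant_on_closure[OF c1 c2 this]
  have "integral {s..1} w - u 1 = - u s" .
  then show ?thesis
    by (simp add: algebra_simps)
qed

lemma integral_Omega_right:
  fixes g :: "real \<Rightarrow> complex"
  assumes g: "integrable (lebesgue_on Omega) g" and s: "-1 \<le> s"
  shows "(LINT t|lebesgue_on Omega. (if t \<in> {s<..} then g t else 0)) = integral {s..1} g"
proof -
  have "(LINT t|lebesgue_on Omega. (if t \<in> {s<..} then g t else 0)) =
      integral\<^sup>L (lebesgue_on ({s<..} \<inter> Omega)) g"
    by (rule Lebesgue_Measure.integral_restrict_Int) auto
  also have "{s<..} \<inter> Omega = {s<..<1}"
    using s by auto
  also have "integral\<^sup>L (lebesgue_on {s<..<1}) g = integral {s<..<1} g"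
    by (intro lebesgue_integral_eq_integral integrable_Omega_subset[OF g]) (use s in auto)
  finally show ?thesis
    by (simp add: integral_open_interval_real)
qed

section \<open>From the weak to the classical form\<close>

lemma integral_to_right_end_deriv:
  fixes f :: "real \<Rightarrow> complex"
  assumes f: "f integrable_on {a..b}" and s: "s \<in> {a<..<b}" and c: "isCont f s"
  shows "((\<lambda>s. integral {s..b} f) has_vector_derivative - f s) (at s)"
proof -
  have "((\<lambda>u. integral {a..u} f) has_vector_derivative f s) (at s within {a..b})"
    using integral_has_vector_derivative_continuous_at[OF f, of s "{}"] s c
    by (simp add: continuous_at_imp_continuous_at_within)
  moreover have "at s within {a..b} = at s"
    by (rule at_within_interior) (use s in simp)
  ultimately have "((\<lambda>u. integral {a..u} f) has_vector_derivative f s) (at s)"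
    by simp
  from has_vector_derivative_diff[OF has_vector_derivative_const[of "integral {a..b} f"] this]
  have "((\<lambda>u. integral {a..b} f - integral {a..u} f) has_vector_derivative - f s) (at s)"
    by simp
  moreover have *: "integral {a..b} f - integral {a..u} f = integral {u..b} f" if "u \<in> {a<..<b}" for u
    using Henstock_Kurzweil_Integration.integral_combine[of a u b f] that f by (simp add: algebra_simps)
  ultimately show ?thesis
    by (rule has_vector_derivative_transform_within_open[OF _ open_greaterThanLessThan s])
qed

text \<open>P is the continuous representative of u'. The function e stands in for the coefficient,
  with which it has to agree only off the finite set S: it is Borel and bounded even if
  \<open>c\<close> takes arbitrary values at the interfaces.\<close>

lemma helmholtz_solution_classical:
  fixes e :: "real \<Rightarrow> real"
  assumes sol: "helmholtz_solution c \<omega> g1 g2 u"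
    and e: "e \<in> borel_measurable borel" "\<And>t. t \<in> Omega \<Longrightarrow> \<bar>e t\<bar> \<le> B"
    and S: "finite S" "\<And>t. t \<in> Omega - S \<Longrightarrow> (\<omega> / c t)\<^sup>2 = e t" "\<And>t. t \<in> Omega - S \<Longrightarrow> isCont e t"
  obtains P where "continuous_on {-1..1} u" "continuous_on {-1..1} P"
    "\<And>t. t \<in> Omega - S \<Longrightarrow> (u has_vector_derivative P t) (at t)"
    "\<And>t. t \<in> Omega - S \<Longrightarrow> (P has_vector_derivative - (of_real (e t) * u t)) (at t)"
    "P (-1) = - g1 - \<i> * of_real (\<omega> / c (-1)) * u (-1)"
    "P 1 = g2 + \<i> * of_real (\<omega> / c 1) * u 1"
proof -
  from sol have uH: "u \<in> H1_Omega"
    and weak: "\<And>v. v \<in> H1_Omega \<Longrightarrow>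
      (LINT t|lebesgue_on Omega. weak_deriv Omega 1 u t * cnj (weak_deriv Omega 1 v t)
        - of_real ((\<omega> / c t)\<^sup>2) * u t * cnj (v t))
      - \<i> * (\<Sum>t\<in>{-1, 1}. of_real (\<omega> / c t) * u t * cnj (v t)) = g1 * cnj (v (-1)) + g2 * cnj (v 1)"
    by (auto simp: helmholtz_solution_def)
  from uH have u: "continuous_on {-1..1} u"
    by (simp add: H1_Omega_def)
  obtain w where w: "has_weak_deriv Omega 1 u w" "w square_integrable_on Omega"
    using uH by (auto simp: H1_Omega_def sobolev_def)
  have wi: "integrable (lebesgue_on Omega) w"
    by (rule square_integrable_imp_integrable_Omega[OF w(2)])
  have wm: "w \<in> borel_measurable (lebesgue_on Omega)"
    using wi by simp
  have um: "u \<in> borel_measurable (lebesgue_on Omega)"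
    by (rule continuous_measurable_Omega[OF u])
  have em: "e \<in> borel_measurable (lebesgue_on Omega)"
    using e(1) by (simp add: measurable_completion measurable_restrict_space1)
  define f where "f = (\<lambda>t. of_real (e t) * u t)"
  have fm: "f \<in> borel_measurable (lebesgue_on Omega)"
    unfolding f_def using em um by measurable
  have fi: "integrable (lebesgue_on Omega) (\<lambda>t. f t * v t)" if v: "continuous_on {-1..1} v" for v
  proof -
    obtain C where C: "\<And>t. t \<in> Omega \<Longrightarrow> cmod (u t * v t) \<le> C"
      using continuous_bounded_Omega[OF continuous_on_mult[OF u v]] by blast
    show ?thesis
    proof (rule bounded_integrable_Omega)
      show "(\<lambda>t. f t * v t) \<in> borel_measurable (lebesgue_on Omega)"
        using fm continuous_measurable_Omega[OF v] by measurable
      show "norm (f t * v t) \<le> B * C" if "t \<in> Omega" for t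
      proof -
        have "norm (f t * v t) = \<bar>e t\<bar> * cmod (u t * v t)"
          by (simp add: f_def norm_mult)
        also have "\<dots> \<le> B * C"
          by (intro mult_mono' e C that) auto
        finally show ?thesis .
      qed
    qed
  qed
  \<comment> \<open>The weak form for piecewise C1 test functions, with the chosen representatives
    \<open>weak_deriv\<close> and the coefficient replaced by explicit functions that agree with
    them almost everywhere.\<close>
  have test: "(LINT t|lebesgue_on Omega. w t * cnj (\<psi> t) - f t * cnj (v t))
      - \<i> * (of_real (\<omega> / c (-1)) * u (-1) * cnj (v (-1)) + of_real (\<omega> / c 1) * u 1 * cnj (v 1))
      = g1 * cnj (v (-1)) + g2 * cnj (v 1)"
    if v: "continuous_on {-1..1} v" "finite F" "\<And>t. t \<in> Omega - F \<Longrightarrow> (v has_vector_derivative \<psi> t) (at t)"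
      "\<psi> \<in> borel_measurable (lebesgue_on Omega)" "\<And>t. t \<in> Omega \<Longrightarrow> cmod (\<psi> t) \<le> C" for v \<psi> F C
  proof -
    have [measurable]: "cnj \<in> borel_measurable borel"
      by (intro borel_measurable_continuous_onI continuous_intros)
    have meas: "(\<lambda>t. w t * cnj (\<psi> t) - f t * cnj (v t)) \<in> borel_measurable (lebesgue_on Omega)"
      using fm wm v(4) continuous_measurable_Omega[OF v(1)] by measurable
    have "AE t in lebesgue_on Omega. t \<in> Omega"
      by (rule AE_I2) simp
    with weak_deriv_AE_eq[OF w(1)] weak_deriv_AE_eq[OF piecewise_C1_has_weak_deriv[OF v]]
      AE_lebesgue_on_finite[OF S(1), of Omega]
    have "AE t in lebesgue_on Omega. w t * cnj (\<psi> t) - f t * cnj (v t) =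
      weak_deriv Omega 1 u t * cnj (weak_deriv Omega 1 v t) - of_real ((\<omega> / c t)\<^sup>2) * u t * cnj (v t)"
      using S(2) by (auto simp: f_def simp del: of_real_power elim!: eventually_elim2)
    from lebesgue_on_integral_cong_AE[OF _ meas this] weak[OF piecewise_C1_in_H1[OF v]]
    show ?thesis
      by simp
  qed
  have fh: "f integrable_on {-1..1}" "(\<lambda>t. f t * of_real t) integrable_on {-1..1}"
    using integrable_on_lebesgue_on[OF fi[of "\<lambda>_. 1"]]
      integrable_on_lebesgue_on[OF fi[of "\<lambda>t. of_real t"]]
    by (auto simp: integrable_on_open_interval_real intro!: continuous_intros)
  \<comment> \<open>\<kappa> is the value of u' at 1 that the impedance condition dictates. With u''
    = - f, \<open>P\<close> is then u' integrated back from 1, and \<open>R\<close> is Taylor's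
    formula at 1 with its remainder, the integral of (t - s) f t over [s, 1], split into two
    integrals whose integrands do not contain s.\<close>
  define \<kappa> where "\<kappa> = g2 + \<i> * of_real (\<omega> / c 1) * u 1"
  define P where "P = (\<lambda>s. \<kappa> + integral {s..1} f)"
  define R where "R = (\<lambda>s. u 1 - of_real (1 - s) * \<kappa> - integral {s..1} (\<lambda>t. f t * of_real t)
      + of_real s * integral {s..1} f)"
  have uR: "u s = R s" if s: "s \<in> Omega" for s
  proof -
    \<comment> \<open>The ramp vanishes at -1, which eliminates \<open>g1\<close>, and its
      derivative is the indicator of t > s, which turns the integral of w into u 1 - u s. Solving
      the tested equation for u s gives \<open>R\<close>.\<close>
    let ?v = "\<lambda>t. of_real (max 0 (t - s)) :: complex"
    let ?\<psi> = "\<lambda>t. (if t \<in> {s<..} then 1 else 0) :: complex"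
    have vc: "continuous_on {-1..1} ?v"
      by (intro continuous_intros)
    have vd: "(?v has_vector_derivative ?\<psi> t) (at t)" if "t \<in> Omega - {s}" for t
    proof (cases "t < s")
      case True
      have "((\<lambda>_. 0) has_vector_derivative (0::complex)) (at t)"
        by simp
      then have "(?v has_vector_derivative 0) (at t)"
        by (rule has_vector_derivative_transform_within_open[where S="{..<s}"]) (use True in auto)
      with True show ?thesis
        by simp
    next
      case False
      have "((\<lambda>t. of_real (t - s)) has_vector_derivative (of_real 1::complex)) (at t)"
        by (intro has_vector_derivative_of_real)
          (auto intro!: derivative_eq_intros simp flip: has_real_derivative_iff_has_vector_derivative)
      then have "(?v has_vector_derivative of_real 1) (at t)"
        by (rule has_vector_derivative_transform_within_open[where S="{s<..}"]) (use False that in auto)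
      with False that show ?thesis
        by simp
    qed
    have \<psi>m: "?\<psi> \<in> borel_measurable (lebesgue_on Omega)"
      by (intro measurable_completion measurable_restrict_space1) simp
    have i1: "integrable (lebesgue_on Omega) (\<lambda>t. if t \<in> {s<..} then w t else 0)"
    proof (rule Bochner_Integration.integrable_bound[OF wi])
      have "(\<lambda>t. w t * ?\<psi> t) \<in> borel_measurable (lebesgue_on Omega)"
        using wm \<psi>m by measurable
      then show "(\<lambda>t. if t \<in> {s<..} then w t else 0) \<in> borel_measurable (lebesgue_on Omega)"
        by (rule measurable_lebesgue_cong[THEN iffD1, rotated]) simp
    qed auto
    have i2: "integrable (lebesgue_on Omega) (\<lambda>t. f t * ?v t)"
      by (rule fi[OF vc])
    have fs: "integrable (lebesgue_on Omega) (\<lambda>t. f t * of_real (t - s))"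
      by (intro fi continuous_intros)
    have "(LINT t|lebesgue_on Omega. w t * cnj (?\<psi> t) - f t * cnj (?v t)) =
        (LINT t|lebesgue_on Omega. (if t \<in> {s<..} then w t else 0) - f t * ?v t)"
      by (rule Bochner_Integration.integral_cong) auto
    also have "\<dots> = (LINT t|lebesgue_on Omega. (if t \<in> {s<..} then w t else 0))
        - (LINT t|lebesgue_on Omega. f t * ?v t)"
      by (rule Bochner_Integration.integral_diff[OF i1 i2])
    also have "(LINT t|lebesgue_on Omega. f t * ?v t) =
        (LINT t|lebesgue_on Omega. (if t \<in> {s<..} then f t * of_real (t - s) else 0))"
      by (rule Bochner_Integration.integral_cong) auto
    also have "\<dots> = integral {s..1} (\<lambda>t. f t * of_real (t - s))"
      using integral_Omega_right[OF fs] s by simp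
    also have "\<dots> = integral {s..1} (\<lambda>t. f t * of_real t - f t * of_real s)"
      by (simp add: algebra_simps)
    also have "\<dots> = integral {s..1} (\<lambda>t. f t * of_real t) - integral {s..1} (\<lambda>t. f t * of_real s)"
    proof (rule Henstock_Kurzweil_Integration.integral_diff)
      have "{s..1} \<subseteq> {-1..1}"
        using s by auto
      then show "(\<lambda>t. f t * of_real t) integrable_on {s..1}" "(\<lambda>t. f t * of_real s) integrable_on {s..1}"
        using integrable_on_subinterval[OF fh(1)] integrable_on_subinterval[OF fh(2)]
        by (auto intro!: integrable_on_mult_left)
    qed
    also have "integral {s..1} (\<lambda>t. f t * of_real s) = of_real s * integral {s..1} f"
      by simp
    also have "(LINT t|lebesgue_on Omega. (if t \<in> {s<..} then w t else 0)) = integral {s..1} w"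
      using integral_Omega_right[OF wi] s by simp
    also have "\<dots> = u 1 - u s"
      using weak_deriv_has_integral_closed[OF u w(1) wi] s by simp
    finally have L: "(LINT t|lebesgue_on Omega. w t * cnj (?\<psi> t) - f t * cnj (?v t)) =
      u 1 - u s - (integral {s..1} (\<lambda>t. f t * of_real t) - of_real s * integral {s..1} f)" .
    have "max 0 (-1 - s) = 0" "max 0 (1 - s) = 1 - s"
      using s by auto
    with test[of ?v "{s}" ?\<psi> 1, OF vc _ vd \<psi>m]
    have "(u 1 - u s - (integral {s..1} (\<lambda>t. f t * of_real t) - of_real s * integral {s..1} f))
        - \<i> * (of_real (\<omega> / c 1) * u 1 * of_real (1 - s)) = g2 * of_real (1 - s)"
      unfolding L by (simp del: of_real_diff of_real_divide)
    then show ?thesis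
      unfolding R_def \<kappa>_def by algebra
  qed
  have Pc: "continuous_on {-1..1} P"
    unfolding P_def by (intro continuous_intros indefinite_integral_continuous_1' fh)
  have P1: "P 1 = g2 + \<i> * of_real (\<omega> / c 1) * u 1"
    by (simp add: P_def \<kappa>_def)
  \<comment> \<open>The constant test function 1 relates the two boundary conditions through the
    integral of f, so the condition at 1 built into \<open>P\<close> yields the one at -1.\<close>
  have "(LINT t|lebesgue_on Omega. - f t)
      - \<i> * (of_real (\<omega> / c (-1)) * u (-1) + of_real (\<omega> / c 1) * u 1) = g1 + g2"
    using test[of "\<lambda>_. 1" "{}" "\<lambda>_. 0" 0] by simp
  moreover have "(LINT t|lebesgue_on Omega. - f t) = - integral {-1..1} f"
    using lebesgue_integral_eq_integral[of Omega f] fi[of "\<lambda>_. 1"]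
    by (simp add: integral_open_interval_real)
  ultimately have "- integral {-1..1} f
      - \<i> * (of_real (\<omega> / c (-1)) * u (-1) + of_real (\<omega> / c 1) * u 1) = g1 + g2"
    by (simp only:)
  then have Pm1: "P (-1) = - g1 - \<i> * of_real (\<omega> / c (-1)) * u (-1)"
    unfolding P_def \<kappa>_def by algebra
  have fc: "isCont f t" if "t \<in> Omega - S" for t
  proof -
    have "isCont u t"
      using continuous_on_interior[OF u, of t] that by simp
    then show ?thesis
      unfolding f_def using S(3)[OF that] by (intro continuous_intros)
  qed
  have I1: "((\<lambda>s. integral {s..1} f) has_vector_derivative - f t) (at t)" if "t \<in> Omega - S" for t
    using integral_to_right_end_deriv[OF fh(1) _ fc[OF that]] that by simp
  have Pd: "(P has_vector_derivative - (of_real (e t) * u t)) (at t)" if "t \<in> Omega - S" for t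
    using has_vector_derivative_add[OF has_vector_derivative_const[of \<kappa>] I1[OF that]]
    unfolding P_def f_def by simp
  have ud: "(u has_vector_derivative P t) (at t)" if t: "t \<in> Omega - S" for t
  proof -
    have I2: "((\<lambda>s. integral {s..1} (\<lambda>t. f t * of_real t)) has_vector_derivative - (f t * of_real t)) (at t)"
      using integral_to_right_end_deriv[OF fh(2), of t] fc[OF t] t by (simp add: continuous_intros)
    have id: "((\<lambda>s. of_real s) has_vector_derivative (1::complex)) (at t)"
      using has_vector_derivative_of_real[of "\<lambda>s. s" 1 "at t"] by simp
    have 1: "((\<lambda>s. of_real (1 - s) * \<kappa>) has_vector_derivative - \<kappa>) (at t)"
      unfolding of_real_diff using id by (auto intro!: derivative_eq_intros)
    \<comment> \<open>The two terms t f(t), one from each integral, cancel, and \<kappa> plus the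
      integral of f over [t, 1] remains.\<close>
    have "(R has_vector_derivative (0 - - \<kappa> - - (f t * of_real t) + (of_real t * - f t + 1 * integral {t..1} f))) (at t)"
      unfolding R_def
      by (intro has_vector_derivative_add has_vector_derivative_diff has_vector_derivative_const
          has_vector_derivative_mult 1 I2 I1[OF t] id)
    then have "(R has_vector_derivative P t) (at t)"
      by (simp add: P_def algebra_simps)
    then show ?thesis
      by (rule has_vector_derivative_transform_within_open[where S=Omega]) (use uR t in auto)
  qed
  show ?thesis
    by (rule that[OF u Pc ud Pd Pm1 P1])
qed

section \<open>Waves in one layer and across an interface\<close>

text \<open>If u t = a exp(i k t) + b exp(-i k t) and P = u', this is the summand a exp(i k t), and
  \<open>left_wave\<close> is the other one. Since k depends on the layer, the two parts may jump at
  an interface although u and P are continuous.\<close>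

definition right_wave :: "real \<Rightarrow> (real \<Rightarrow> complex) \<Rightarrow> (real \<Rightarrow> complex) \<Rightarrow> real \<Rightarrow> complex" where
  "right_wave k u P t = (u t - \<i> / of_real k * P t) / 2"

definition left_wave :: "real \<Rightarrow> (real \<Rightarrow> complex) \<Rightarrow> (real \<Rightarrow> complex) \<Rightarrow> real \<Rightarrow> complex" where
  "left_wave k u P t = (u t + \<i> / of_real k * P t) / 2"

lemma wave_sum: "right_wave k u P t + left_wave k u P t = u t"
  by (simp add: right_wave_def left_wave_def field_simps)

lemma wave_diff: "k \<noteq> 0 \<Longrightarrow> \<i> * of_real k * (right_wave k u P t - left_wave k u P t) = P t"
  by (simp add: right_wave_def left_wave_def field_simps)

lemma left_wave_eq_right_wave: "left_wave k u P t = right_wave (- k) u P t"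
  by (simp add: right_wave_def left_wave_def)

text \<open>The second-order equation gives A' = i k A for the right-going part A, so exp(-i k (t -
  a)) A is constant. Continuity at the end points carries the formula to the closed layer. The sign
  of k is left free because the left-going part is the right-going one for -k.\<close>

lemma right_wave_propagation:
  assumes ab: "a < b" and k: "k \<noteq> 0" and c: "continuous_on {a..b} u" "continuous_on {a..b} P"
    and u: "\<And>t. t \<in> {a<..<b} \<Longrightarrow> (u has_vector_derivative P t) (at t)"
    and P: "\<And>t. t \<in> {a<..<b} \<Longrightarrow> (P has_vector_derivative - (of_real (k\<^sup>2) * u t)) (at t)"
    and t: "t \<in> {a..b}"
  shows "right_wave k u P t = exp (\<i> * of_real (k * (t - a))) * right_wave k u P a"
proof -
  define F where "F = (\<lambda>t. exp (- \<i> * of_real (k * (t - a))) * right_wave k u P t)"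
  have "F t = right_wave k u P a"
  proof (rule has_derivative_zero_unique_strong_interval[of "{a, b}" a b])
    show "continuous_on {a..b} F"
      unfolding F_def right_wave_def using k by (intro continuous_intros c) auto
    show "F a = right_wave k u P a"
      by (simp add: F_def)
    show "(F has_derivative (\<lambda>h. 0)) (at s within {a..b})" if "s \<in> {a..b} - {a, b}" for s
    proof -
      have s: "s \<in> {a<..<b}" using that by auto
      have e: "((\<lambda>t. exp (- \<i> * of_real (k * (t - a)))) has_vector_derivative
          (- \<i> * of_real k) * exp (- \<i> * of_real (k * (s - a)))) (at s)"
      proof -
        have "((\<lambda>t. - \<i> * (of_real k * (of_real t - of_real a))) has_vector_derivative - \<i> * of_real k) (at s)"
          using has_vector_derivative_of_real[of "\<lambda>s. s" 1 "at s", where ?'a=complex]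
          by (auto intro!: derivative_eq_intros)
        from field_vector_diff_chain_at[OF this DERIV_exp] show ?thesis
          by (simp add: o_def mult.commute)
      qed
      have r: "(right_wave k u P has_vector_derivative (\<i> * of_real k) * right_wave k u P s) (at s)"
      proof -
        have "((\<lambda>t. (u t - \<i> / of_real k * P t) * (1 / 2)) has_vector_derivative
            (P s - \<i> / of_real k * (- (of_real (k\<^sup>2) * u s))) * (1 / 2)) (at s)"
          by (intro has_vector_derivative_mult_left has_vector_derivative_diff
              has_vector_derivative_mult_right u[OF s] P[OF s])
        moreover have "(P s - \<i> / of_real k * (- (of_real (k\<^sup>2) * u s))) * (1 / 2) =
            (\<i> * of_real k) * right_wave k u P s"
          using k by (simp add: right_wave_def field_simps power2_eq_square)
        moreover have "(\<lambda>t. (u t - \<i> / of_real k * P t) * (1 / 2)) = right_wave k u P"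
          by (simp add: right_wave_def fun_eq_iff)
        ultimately show ?thesis
          by simp
      qed
      have "(F has_vector_derivative 0) (at s)"
        unfolding F_def using has_vector_derivative_mult[OF e r] by (simp add: algebra_simps)
      then have "(F has_vector_derivative 0) (at s within {a..b})"
        by (rule has_vector_derivative_at_within)
      then show ?thesis
        by (simp add: has_vector_derivative_def)
    qed
  qed (use t in auto)
  then have "exp (\<i> * of_real (k * (t - a))) * (exp (- \<i> * of_real (k * (t - a))) * right_wave k u P t)
      = exp (\<i> * of_real (k * (t - a))) * right_wave k u P a"
    by (simp add: F_def)
  moreover have "exp (\<i> * of_real (k * (t - a))) * exp (- \<i> * of_real (k * (t - a))) = 1"
    by (simp flip: exp_add)
  ultimately show ?thesis
    by (metis mult.assoc mult_1)
qed

lemma left_wave_propagation: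
  assumes "a < b" "k \<noteq> 0" "continuous_on {a..b} u" "continuous_on {a..b} P"
    and "\<And>t. t \<in> {a<..<b} \<Longrightarrow> (u has_vector_derivative P t) (at t)"
    and "\<And>t. t \<in> {a<..<b} \<Longrightarrow> (P has_vector_derivative - (of_real (k\<^sup>2) * u t)) (at t)"
    and "t \<in> {a..b}"
  shows "left_wave k u P t = exp (- \<i> * of_real (k * (t - a))) * left_wave k u P a"
  using right_wave_propagation[of a b "- k" u P t] assms
  by (simp add: left_wave_eq_right_wave)

text \<open>The quantity Im (u cnj P) does not involve k. This links the amplitudes on the two sides
  of an interface.\<close>

lemma wave_flux:
  assumes "k \<noteq> 0"
  shows "(cmod (right_wave k u P t))\<^sup>2 - (cmod (left_wave k u P t))\<^sup>2 = - Im (u t * cnj (P t)) / k"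
proof -
  define w where "w = \<i> / of_real k * P t"
  have w: "Re w = - Im (P t) / k" "Im w = Re (P t) / k"
    by (simp_all add: w_def Re_divide_of_real Im_divide_of_real)
  have "(cmod ((u t - w) / 2))\<^sup>2 - (cmod ((u t + w) / 2))\<^sup>2 = - (Re (u t) * Re w + Im (u t) * Im w)"
    unfolding cmod_power2 by (simp add: power2_eq_square field_simps)
  also have "\<dots> = - Im (u t * cnj (P t)) / k"
    unfolding w by (simp add: diff_divide_distrib)
  finally show ?thesis
    by (simp add: right_wave_def left_wave_def w_def)
qed

section \<open>The Moebius map in the recursion and the transmission of waves\<close>

lemma mobius_denominator_nonzero:
  fixes q :: real and Q :: complex
  assumes "\<bar>q\<bar> < 1" "cmod Q < 1"
  shows "1 + of_real q * Q \<noteq> 0"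
proof
  assume "1 + of_real q * Q = 0"
  then have "of_real q * Q = - 1"
    by (simp add: add_eq_0_iff)
  then have "\<bar>q\<bar> * cmod Q = 1"
    by (metis norm_minus_cancel norm_mult norm_of_real norm_one)
  moreover have "\<bar>q\<bar> * cmod Q \<le> cmod Q"
    using assms by (intro mult_left_le_one_le) auto
  ultimately show False
    using assms by simp
qed

text \<open>The identity |1 + q Q|^2 - |q + Q|^2 = (1 - q^2) (1 - |Q|^2) expresses that the map is
  an automorphism of the unit disc. It serves both to keep the sequence inside the disc and to
  compare the weights 1 - |Q|^2 across an interface.\<close>

lemma mobius_defect:
  fixes q :: real and Q :: complex
  assumes "\<bar>q\<bar> < 1" "cmod Q < 1"
  shows "1 - (cmod ((of_real q + Q) / (1 + of_real q * Q)))\<^sup>2 =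
    (1 - q\<^sup>2) * (1 - (cmod Q)\<^sup>2) / (cmod (1 + of_real q * Q))\<^sup>2"
proof -
  have nz: "(cmod (1 + of_real q * Q))\<^sup>2 \<noteq> 0"
    using mobius_denominator_nonzero[OF assms] by simp
  have "(cmod (1 + of_real q * Q))\<^sup>2 - (cmod (of_real q + Q))\<^sup>2 = (1 - q\<^sup>2) * (1 - (cmod Q)\<^sup>2)"
    unfolding cmod_power2 by (simp add: power2_eq_square algebra_simps)
  with nz show ?thesis
    by (simp add: norm_divide power_divide field_simps)
qed

text \<open>With A, B the waves for speed c, A', B' those for speed c', and M the Moebius image of
  Q, continuity of u and P gives A' + M B' = (1 + q) / (1 + q Q) (A + Q B). Taking squared moduli
  and using (1 + q)^2 c = c' (1 - q^2) with \<open>mobius_defect\<close> yields the claim, stated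
  free of denominators.\<close>

lemma wave_interface:
  fixes c c' \<omega> :: real and Q :: complex
  assumes c: "c > 0" "c' > 0" and \<omega>: "\<omega> > 0" and Q: "cmod Q < 1" and q: "q = (c' - c) / (c' + c)"
  shows "(cmod (right_wave (\<omega> / c') u P t
        + (of_real q + Q) / (1 + of_real q * Q) * left_wave (\<omega> / c') u P t))\<^sup>2 * c
      * (1 - (cmod Q)\<^sup>2)
    = (cmod (right_wave (\<omega> / c) u P t + Q * left_wave (\<omega> / c) u P t))\<^sup>2 * c'
      * (1 - (cmod ((of_real q + Q) / (1 + of_real q * Q)))\<^sup>2)"
proof -
  have q1: "\<bar>q\<bar> < 1"
    using c by (auto simp: q abs_if field_simps)
  define d where "d = 1 + of_real q * Q"
  have d: "d \<noteq> 0"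
    unfolding d_def by (rule mobius_denominator_nonzero[OF q1 Q])
  have fraction: "X / 2 + M / d * (Y / 2) = m / d * (A / 2 + Q * (B / 2))"
    if "d * X + M * Y = m * (A + Q * B)" for X Y M m A B :: complex
  proof -
    have e1: "X / 2 + M / d * (Y / 2) = (d * X + M * Y) / (2 * d)"
      using d by (simp add: field_simps)
    have e2: "A / 2 + Q * (B / 2) = (A + Q * B) / 2"
      by (simp add: add_divide_distrib)
    show ?thesis
      unfolding e1 that e2 by simp
  qed
  \<comment> \<open>In terms of this z, common to both sides, the waves for speed s are (u - s z) /
    2 and (u + s z) / 2, so the speed enters only linearly.\<close>
  define z where "z = \<i> / of_real \<omega> * P t"
  have w: "right_wave (\<omega> / s) u P t = (u t - of_real s * z) / 2"
    "left_wave (\<omega> / s) u P t = (u t + of_real s * z) / 2" for s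
    by (simp_all add: right_wave_def left_wave_def z_def)
  have "q * (c + c') = c' - c"
    using c by (simp add: q field_simps)
  then have qc: "of_real q * of_real (c + c') = (of_real (c' - c) :: complex)"
    by (metis of_real_mult)
  have "d * (u t - of_real c' * z) + (of_real q + Q) * (u t + of_real c' * z) =
      (1 + of_real q) * ((u t - of_real c * z) + Q * (u t + of_real c * z))"
  proof -
    \<comment> \<open>The definition of q in the form c' (1 - q) = c (1 + q); it is what matches the
      coefficients of z.\<close>
    have 1: "of_real c' * (1 - of_real q) = (1 + of_real q) * (of_real c :: complex)"
      using qc by (simp add: algebra_simps)
    have "d * (u t - of_real c' * z) + (of_real q + Q) * (u t + of_real c' * z) =
        (1 + of_real q) * (1 + Q) * u t - (of_real c' * (1 - of_real q)) * (1 - Q) * z"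
      by (simp add: d_def algebra_simps)
    also have "\<dots> = (1 + of_real q) * ((u t - of_real c * z) + Q * (u t + of_real c * z))"
      unfolding 1 by (simp add: algebra_simps)
    finally show ?thesis .
  qed
  then have "right_wave (\<omega> / c') u P t + (of_real q + Q) / d * left_wave (\<omega> / c') u P t =
      of_real (1 + q) / d * (right_wave (\<omega> / c) u P t + Q * left_wave (\<omega> / c) u P t)"
    unfolding w using d by (intro fraction) simp_all
  then have "(cmod (right_wave (\<omega> / c') u P t + (of_real q + Q) / d * left_wave (\<omega> / c') u P t))\<^sup>2 =
      (1 + q)\<^sup>2 / (cmod d)\<^sup>2 * (cmod (right_wave (\<omega> / c) u P t + Q * left_wave (\<omega> / c) u P t))\<^sup>2"
    by (simp add: norm_mult norm_divide power_mult_distrib power_divide del: of_real_add)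
  moreover have "(1 + q)\<^sup>2 * c = c' * (1 - q\<^sup>2)"
  proof -
    have "(1 + q) * c = c' * (1 - q)"
      using c by (simp add: q field_simps)
    then have "(1 + q) * ((1 + q) * c) = (1 + q) * (c' * (1 - q))"
      by simp
    then show ?thesis
      by (simp add: power2_eq_square algebra_simps)
  qed
  ultimately show ?thesis
    unfolding mobius_defect[OF q1 Q] unfolding d_def[symmetric]
    by (simp add: times_divide_eq_left times_divide_eq_right)
qed

text \<open>Substituting the bound for \<alpha> into the flux inequality leaves a quadratic
  inequality for \<beta>. It gives s \<beta> <= (p + sqrt 2) N with s = sqrt (1 - p^2), hence s
  \<alpha> <= (1 + p sqrt 2) N. The sum of the right sides is (1 + p) (1 + sqrt 2) N, and p <
  1.\<close>

lemma amplitude_bound: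
  fixes \<alpha> \<beta> p N :: real
  assumes p: "0 \<le> p" "p < 1" and N: "N \<ge> 0" and \<beta>: "\<beta> \<ge> 0" "\<alpha> \<ge> 0"
    and le: "\<alpha> \<le> p * \<beta> + sqrt (1 - p\<^sup>2) * N" and flux: "\<beta>\<^sup>2 - \<alpha>\<^sup>2 \<le> N\<^sup>2"
  shows "\<alpha> + \<beta> \<le> 2 * (1 + sqrt 2) * N * (1 / sqrt (1 - p\<^sup>2))"
proof -
  define s where "s = sqrt (1 - p\<^sup>2)"
  have p2: "p\<^sup>2 < 1"
    using p by (simp add: power_less_one_iff abs_square_less_1)
  have s: "s > 0" "s\<^sup>2 = 1 - p\<^sup>2"
    using p2 by (auto simp: s_def)
  have "\<alpha>\<^sup>2 \<le> (p * \<beta> + s * N)\<^sup>2"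
    using le \<beta> by (intro power_mono) (auto simp: s_def)
  with flux have "\<beta>\<^sup>2 \<le> N\<^sup>2 + (p * \<beta> + s * N)\<^sup>2"
    by simp
  then have "s\<^sup>2 * \<beta>\<^sup>2 - 2 * p * s * \<beta> * N \<le> (1 + s\<^sup>2) * N\<^sup>2"
    unfolding s(2) by (simp add: s(2) power2_sum power_mult_distrib algebra_simps)
  \<comment> \<open>Adding p^2 N^2 completes the square; on the right p^2 + s^2 = 1 leaves exactly 2
    N^2.\<close>
  then have "(s * \<beta> - p * N)\<^sup>2 \<le> (sqrt 2 * N)\<^sup>2"
    unfolding s(2) by (simp add: power2_diff power_mult_distrib s(2) algebra_simps)
  then have "s * \<beta> - p * N \<le> sqrt 2 * N"
    by (rule power2_le_imp_le) (use N in simp)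
  then have b: "s * \<beta> \<le> (p + sqrt 2) * N"
    by (simp add: algebra_simps)
  have "s * \<alpha> \<le> s * (p * \<beta> + s * N)"
    using le s by (intro mult_left_mono) (auto simp: s_def)
  also have "\<dots> = p * (s * \<beta>) + s\<^sup>2 * N"
    by (simp add: algebra_simps power2_eq_square)
  also have "\<dots> \<le> p * ((p + sqrt 2) * N) + s\<^sup>2 * N"
    using b p by (intro add_right_mono mult_left_mono) auto
  also have "\<dots> = (1 + p * sqrt 2) * N"
    unfolding s(2) by (simp add: algebra_simps power2_eq_square)
  finally have "s * (\<alpha> + \<beta>) \<le> (1 + p * sqrt 2) * N + (p + sqrt 2) * N"
    using b by (simp add: algebra_simps)
  also have "\<dots> = ((1 + p) * (1 + sqrt 2)) * N"
    by (simp add: algebra_simps)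
  also have "\<dots> \<le> (2 * (1 + sqrt 2)) * N"
    using p N by (intro mult_right_mono) auto
  finally show ?thesis
    using s(1) by (simp add: s_def[symmetric] field_simps)
qed

text \<open>The dummy value 0 at index 0 makes the start of the sequence an instance of the
  recursion: nothing is reflected to the left of the first layer.\<close>

lemma Qseq_Suc:
  "Qseq x c \<omega> (Suc j) = (of_real (jump_ratio c (Suc j)) + Qseq x c \<omega> j) /
     (1 + of_real (jump_ratio c (Suc j)) * Qseq x c \<omega> j) / sigma x c \<omega> (Suc j)"
  by (cases j) (simp_all add: divide_divide_eq_left mult.commute)

lemma cmod_sigma: "cmod (sigma x c \<omega> j) = 1"
  unfolding sigma_def norm_exp_eq_Re by simp

lemma jump_ratio_bound:
  assumes "c j > 0" "c (Suc j) > 0"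
  shows "\<bar>jump_ratio c j\<bar> < 1"
  using assms by (auto simp: jump_ratio_def abs_if field_simps)

text \<open>Each step applies an automorphism of the unit disc and then divides by a number of
  modulus 1.\<close>

lemma cmod_Qseq_less_1:
  assumes "\<And>i. i \<in> {1..n + 1} \<Longrightarrow> c i > 0" "j \<le> n"
  shows "cmod (Qseq x c \<omega> j) < 1"
  using assms(2)
proof (induction j)
  case (Suc j)
  let ?q = "jump_ratio c (Suc j)" and ?Q = "Qseq x c \<omega> j"
  have q: "\<bar>?q\<bar> < 1"
    using assms(1) Suc.prems by (intro jump_ratio_bound) auto
  have Q: "cmod ?Q < 1"
    using Suc by simp
  have "1 - (cmod ((of_real ?q + ?Q) / (1 + of_real ?q * ?Q)))\<^sup>2 > 0"
    unfolding mobius_defect[OF q Q]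
    using q Q mobius_denominator_nonzero[OF q Q]
    by (intro divide_pos_pos mult_pos_pos) (auto simp: abs_square_less_1 power_less_one_iff)
  then have "(cmod (Qseq x c \<omega> (Suc j)))\<^sup>2 < 1"
    unfolding Qseq_Suc norm_divide cmod_sigma by simp
  then show ?case
    by (simp add: abs_square_less_1)
qed simp

section \<open>Waves in a layered medium\<close>

lemma partition_mono:
  fixes x :: "nat \<Rightarrow> real"
  assumes "\<And>j. j \<le> n \<Longrightarrow> x j < x (j + 1)" "j \<le> n + 1" "i \<le> j"
  shows "x i \<le> x j"
  using assms(3,2)
proof (induction rule: dec_induct)
  case (step m)
  then show ?case
    using assms(1)[of m] by simp
qed simp

lemma partition_cover:
  fixes x :: "nat \<Rightarrow> real"
  assumes "x 0 \<le> t" "t \<le> x (Suc m)"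
  obtains j where "j \<le> m" "x j \<le> t" "t \<le> x (Suc j)"
  using assms
proof (induction m arbitrary: thesis)
  case (Suc m)
  show ?case
  proof (cases "t \<le> x (Suc m)")
    case True
    show ?thesis
      by (rule Suc.IH[OF _ Suc.prems(2) True], rule Suc.prems(1)) auto
  next
    case False
    show ?thesis
      by (rule Suc.prems(1)[of "Suc m"]) (use False Suc.prems(3) in auto)
  qed
qed auto

text \<open>The hypotheses of \<open>amplitude_bound\<close> are collected for one layer: the linear
  one from the invariant of A + Q B at the right end of the layer, the quadratic one from the flux
  at 1. Both transfer to t because |A| and |B| are constant in the layer.\<close>

lemma layered_wave_bound:
  fixes x cs :: "nat \<Rightarrow> real" and \<omega> :: real and u P :: "real \<Rightarrow> complex"
  assumes x: "x 0 = -1" "x (n + 1) = 1" "\<And>j. j \<le> n \<Longrightarrow> x j < x (j + 1)"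
    and cs: "\<And>j. j \<in> {1..n + 1} \<Longrightarrow> cs j > 0" "\<And>j. j \<in> {1..n + 1} \<Longrightarrow> cs j \<le> cmax" and \<omega>: "\<omega> > 0"
    and cont: "continuous_on {-1..1} u" "continuous_on {-1..1} P"
    and u: "\<And>j t. j \<le> n \<Longrightarrow> t \<in> {x j<..<x (Suc j)} \<Longrightarrow> (u has_vector_derivative P t) (at t)"
    and P: "\<And>j t. j \<le> n \<Longrightarrow> t \<in> {x j<..<x (Suc j)} \<Longrightarrow>
      (P has_vector_derivative - (of_real ((\<omega> / cs (Suc j))\<^sup>2) * u t)) (at t)"
    and bc: "P (-1) = - g1 - \<i> * of_real (\<omega> / cs 1) * u (-1)"
      "P 1 = g2 + \<i> * of_real (\<omega> / cs (n + 1)) * u 1"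
    and G: "cmod g1 \<le> G" "cmod g2 \<le> G"
    and j: "j \<le> n" and t: "t \<in> {x j..x (Suc j)}"
  defines "k \<equiv> \<omega> / cs (Suc j)"
  shows "cmod (right_wave k u P t) + cmod (left_wave k u P t)
    \<le> 2 * (1 + sqrt 2) * (cmax * G / (2 * \<omega>)) * (1 / sqrt (1 - (cmod (Qseq x cs \<omega> j))\<^sup>2))"
proof -
  \<comment> \<open>Index shift: \<open>K j\<close>, \<open>A j\<close> and \<open>B j\<close>
    belong to the layer from \<open>x j\<close> to \<open>x (Suc j)\<close>, whose speed is
    \<open>cs (Suc j)\<close>.\<close>
  define K where "K = (\<lambda>j. \<omega> / cs (Suc j))"
  define A where "A = (\<lambda>j t. right_wave (K j) u P t)"
  define B where "B = (\<lambda>j t. left_wave (K j) u P t)"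
  define Q where "Q = Qseq x cs \<omega>"
  define N where "N = cmax * G / (2 * \<omega>)"
  have cpos: "cs (Suc i) > 0" "cs (Suc i) \<le> cmax" if "i \<le> n" for i
    using cs that by auto
  have K: "K i \<noteq> 0" if "i \<le> n" for i
    using cpos[OF that] \<omega> by (simp add: K_def)
  have xb: "-1 \<le> x i" "x i \<le> 1" if "i \<le> n + 1" for i
    using partition_mono[of n x i 0] partition_mono[of n x "n + 1" i] x that by auto
  have sub: "{x i..x (Suc i)} \<subseteq> {-1..1}" if "i \<le> n" for i
    using xb[of i] xb[of "Suc i"] that by auto
  have xlt: "x i < x (Suc i)" if "i \<le> n" for i
    using x(3) that by simp
  have propA: "A i s = exp (\<i> * of_real (K i * (s - x i))) * A i (x i)"
    and propB: "B i s = exp (- \<i> * of_real (K i * (s - x i))) * B i (x i)"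
    if "i \<le> n" "s \<in> {x i..x (Suc i)}" for i s
    unfolding A_def B_def
    by (intro right_wave_propagation[of "x i" "x (Suc i)"] left_wave_propagation[of "x i" "x (Suc i)"]
        xlt K continuous_on_subset[OF cont(1)] continuous_on_subset[OF cont(2)] sub that;
        use u P that in \<open>auto simp: K_def\<close>)+
  have normA: "cmod (A i s) = cmod (A i (x i))" and normB: "cmod (B i s) = cmod (B i (x i))"
    if "i \<le> n" "s \<in> {x i..x (Suc i)}" for i s
    unfolding propA[OF that] propB[OF that] norm_mult norm_exp_eq_Re by simp_all
  \<comment> \<open>The flux with the speed of the layer divided out. It is a function of u and P
    alone, so its constancy inside layers can be chained through the shared nodes.\<close>
  define F where "F = (\<lambda>t. - Im (u t * cnj (P t)) / \<omega>)"
  have flux: "(cmod (A i s))\<^sup>2 - (cmod (B i s))\<^sup>2 = cs (Suc i) * F s" if "i \<le> n" for i s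
    unfolding A_def B_def wave_flux[OF K[OF that]] using cpos[OF that] \<omega> by (simp add: K_def F_def)
  have F_piece: "F s = F (x i)" if "i \<le> n" "s \<in> {x i..x (Suc i)}" for i s
  proof -
    have "cs (Suc i) * F s = cs (Suc i) * F (x i)"
      by (simp only: flux[OF that(1), symmetric] normA[OF that] normB[OF that])
    then show ?thesis
      using cpos[OF that(1)] by simp
  qed
  have F_nodes: "F (x i) = F (x 0)" if "i \<le> n + 1" for i
    using that
  proof (induction i)
    case (Suc i)
    then show ?case
      using F_piece[of i "x (Suc i)"] xlt[of i] by simp
  qed simp
  have F_const: "F s = F 1" if "i \<le> n" "s \<in> {x i..x (Suc i)}" for i s
    using F_piece[OF that] F_nodes[of i] F_nodes[of "n + 1"] that x(2) by simp
  have Q1: "cmod (Q i) < 1" if "i \<le> n" for i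
    unfolding Q_def by (rule cmod_Qseq_less_1[of n]) (use cs that in auto)
  \<comment> \<open>Each impedance condition prescribes the wave entering at its end: the
    right-going one at -1 and the left-going one at 1.\<close>
  have A0: "A 0 (-1) = \<i> * of_real (cs 1 / (2 * \<omega>)) * g1"
    unfolding A_def right_wave_def bc K_def using cpos[of 0] \<omega> by (simp add: field_simps)
  have Bn: "B n 1 = \<i> * of_real (cs (n + 1) / (2 * \<omega>)) * g2"
    unfolding B_def left_wave_def bc K_def using cpos[of n] \<omega> by (simp add: field_simps)
  \<comment> \<open>The invariant is read at the right end of layer i, since dividing by
    \<open>sigma x cs \<omega> i\<close> already accounts for the passage through that layer. It is
    cross-multiplied to avoid quotients.\<close>
  have inv: "(cmod (A i (x (Suc i)) + Q i * B i (x (Suc i))))\<^sup>2 * cs 1 =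
      cs (Suc i) * (1 - (cmod (Q i))\<^sup>2) * (cmod (A 0 (-1)))\<^sup>2" if "i \<le> n" for i
    using that
  proof (induction i)
    case 0
    have "cmod (A 0 (x (Suc 0))) = cmod (A 0 (x 0))"
      by (rule normA) (use xlt[of 0] in auto)
    then show ?case
      by (simp add: Q_def x(1))
  next
    case (Suc i)
    then have i: "i \<le> n" by simp
    let ?y = "x (Suc i)" and ?q = "jump_ratio cs (Suc i)"
    let ?R = "(of_real ?q + Q i) / (1 + of_real ?q * Q i)"
    have c: "cs (Suc i) > 0" "cs (Suc (Suc i)) > 0"
      using cpos(1)[OF i] cpos(1)[OF Suc.prems] by auto
    have QS: "Q (Suc i) = ?R / sigma x cs \<omega> (Suc i)"
      by (simp add: Q_def Qseq_Suc)
    \<comment> \<open>\<theta> is the phase gained across the layer: A picks up exp(i \<theta>), B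
      picks up exp(-i \<theta>), and 1 / \<sigma> is exp(2 i \<theta>). So the combination at the
      right end is exp(i \<theta>) times the one at the left end, with the undivided Moebius value
      as coefficient.\<close>
    define \<theta> where "\<theta> = K (Suc i) * (x (Suc (Suc i)) - ?y)"
    have \<sigma>: "1 / sigma x cs \<omega> (Suc i) = exp (\<i> * of_real \<theta>) * exp (\<i> * of_real \<theta>)"
      by (simp add: sigma_def \<theta>_def K_def exp_minus inverse_eq_divide mult_ac flip: exp_add exp_double)
    have "A (Suc i) (x (Suc (Suc i))) + Q (Suc i) * B (Suc i) (x (Suc (Suc i))) =
        exp (\<i> * of_real \<theta>) * (A (Suc i) ?y + ?R * B (Suc i) ?y)"
    proof -
      have e: "exp (\<i> * of_real \<theta>) * exp (- \<i> * of_real \<theta>) = 1"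
        by (simp flip: exp_add)
      have m: "x (Suc (Suc i)) \<in> {x (Suc i)..x (Suc (Suc i))}"
        using xlt[OF Suc.prems] by simp
      have "Q (Suc i) = ?R * (exp (\<i> * of_real \<theta>) * exp (\<i> * of_real \<theta>))"
        unfolding QS \<sigma>[symmetric] by simp
      moreover have "A (Suc i) (x (Suc (Suc i))) = exp (\<i> * of_real \<theta>) * A (Suc i) ?y"
        "B (Suc i) (x (Suc (Suc i))) = exp (- \<i> * of_real \<theta>) * B (Suc i) ?y"
        using propA[OF Suc.prems m] propB[OF Suc.prems m] by (simp_all add: \<theta>_def)
      ultimately have "A (Suc i) (x (Suc (Suc i))) + Q (Suc i) * B (Suc i) (x (Suc (Suc i))) =
        exp (\<i> * of_real \<theta>) * A (Suc i) ?y
        + ?R * exp (\<i> * of_real \<theta>) * (exp (\<i> * of_real \<theta>) * exp (- \<i> * of_real \<theta>)) * B (Suc i) ?y"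
        by (simp only: mult_ac)
      then show ?thesis
        unfolding e by (simp only: mult_1_left mult_1_right distrib_left mult_ac)
    qed
    then have n1: "cmod (A (Suc i) (x (Suc (Suc i))) + Q (Suc i) * B (Suc i) (x (Suc (Suc i)))) =
        cmod (A (Suc i) ?y + ?R * B (Suc i) ?y)"
      by (simp add: norm_mult)
    have n2: "cmod (Q (Suc i)) = cmod ?R"
      unfolding QS norm_divide cmod_sigma by simp
    have q: "?q = (cs (Suc (Suc i)) - cs (Suc i)) / (cs (Suc (Suc i)) + cs (Suc i))"
      by (simp add: jump_ratio_def)
    define X where "X = (cmod (A (Suc i) ?y + ?R * B (Suc i) ?y))\<^sup>2"
    define Y where "Y = (cmod (A i ?y + Q i * B i ?y))\<^sup>2"
    have W: "X * cs (Suc i) * (1 - (cmod (Q i))\<^sup>2) = Y * cs (Suc (Suc i)) * (1 - (cmod ?R)\<^sup>2)"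
      using wave_interface[OF c \<omega> Q1[OF i] q, of u P ?y]
      unfolding X_def Y_def A_def B_def K_def by simp
    have IH: "Y * cs 1 = cs (Suc i) * (1 - (cmod (Q i))\<^sup>2) * (cmod (A 0 (-1)))\<^sup>2"
      unfolding Y_def using Suc.IH[OF i] .
    have pos: "cs (Suc i) * (1 - (cmod (Q i))\<^sup>2) \<noteq> 0"
      using c Q1[OF i] by (simp add: abs_square_eq_1 power2_eq_1_iff)
    \<comment> \<open>The claim is proved after multiplication by a nonzero factor, so that the
      interface identity and the induction hypothesis can both be substituted as products.\<close>
    have "cs (Suc i) * (1 - (cmod (Q i))\<^sup>2) * (X * cs 1) =
        (X * cs (Suc i) * (1 - (cmod (Q i))\<^sup>2)) * cs 1"
      by (simp only: mult_ac)
    also have "\<dots> = (Y * cs 1) * (cs (Suc (Suc i)) * (1 - (cmod ?R)\<^sup>2))"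
      unfolding W by (simp only: mult_ac)
    also have "\<dots> = cs (Suc i) * (1 - (cmod (Q i))\<^sup>2) *
        (cs (Suc (Suc i)) * (1 - (cmod ?R)\<^sup>2) * (cmod (A 0 (-1)))\<^sup>2)"
      unfolding IH by (simp only: mult_ac)
    finally have "X * cs 1 = cs (Suc (Suc i)) * (1 - (cmod ?R)\<^sup>2) * (cmod (A 0 (-1)))\<^sup>2"
      using pos by (simp only: mult_cancel_left simp_thms)
    then show ?case
      unfolding n1 n2 X_def .
  qed
  have G0: "G \<ge> 0"
    using G(1) by (rule order_trans[OF norm_ge_zero])
  have cmax: "cmax > 0"
    using cpos[of 0] by simp
  have N0: "N \<ge> 0"
    using G0 cmax \<omega> by (simp add: N_def)
  \<comment> \<open>Used twice, with the speed of the current layer and that of a boundary layer: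
    once for \<open>g1\<close> at the left end and once for \<open>g2\<close> at the right
    end.\<close>
  have amp: "c1 * c2 * (cmod g / (2 * \<omega>))\<^sup>2 \<le> N\<^sup>2" if "0 < c1" "c1 \<le> cmax" "0 < c2" "c2 \<le> cmax" "cmod g \<le> G" for c1 c2 g
  proof -
    have "c1 * c2 * (cmod g / (2 * \<omega>))\<^sup>2 \<le> cmax * cmax * (G / (2 * \<omega>))\<^sup>2"
      using that \<omega> G0 by (intro mult_mono power_mono divide_right_mono) auto
    then show ?thesis
      by (simp add: N_def power2_eq_square mult_ac)
  qed
  let ?p = "cmod (Q j)" and ?y = "x (Suc j)"
  have p1: "?p < 1"
    by (rule Q1[OF j])
  then have p2: "?p\<^sup>2 < 1"
    by (simp add: abs_square_less_1)
  have yj: "?y \<in> {x j..x (Suc j)}"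
    using xlt[OF j] by simp
  have eqn: "cmod (A j t) = cmod (A j ?y)" "cmod (B j t) = cmod (B j ?y)"
    using normA[OF j t] normA[OF j yj] normB[OF j t] normB[OF j yj] by simp_all
  have "(cmod (A j ?y + Q j * B j ?y))\<^sup>2 * cs 1 =
      (1 - ?p\<^sup>2) * (cs (Suc j) * cs 1 * (cmod g1 / (2 * \<omega>))\<^sup>2) * cs 1"
    unfolding inv[OF j] A0 using cpos[of 0] \<omega>
    by (simp add: norm_mult norm_divide power_mult_distrib power_divide power2_eq_square mult_ac)
  then have "(cmod (A j ?y + Q j * B j ?y))\<^sup>2 = (1 - ?p\<^sup>2) * (cs (Suc j) * cs 1 * (cmod g1 / (2 * \<omega>))\<^sup>2)"
    using cpos[of 0] by simp
  also have "\<dots> \<le> (1 - ?p\<^sup>2) * N\<^sup>2"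
    using amp[OF cpos[OF j] _ _ G(1), of "cs 1"] cpos[of 0] p2 by (intro mult_left_mono) auto
  also have "\<dots> = (sqrt (1 - ?p\<^sup>2) * N)\<^sup>2"
    using p2 by (simp add: power_mult_distrib)
  finally have "cmod (A j ?y + Q j * B j ?y) \<le> sqrt (1 - ?p\<^sup>2) * N"
    by (rule power2_le_imp_le) (use N0 p2 in simp)
  moreover have "cmod (A j ?y) \<le> cmod (A j ?y + Q j * B j ?y) + cmod (Q j * B j ?y)"
    by (metis add_diff_cancel_right' norm_triangle_ineq4)
  ultimately have le: "cmod (A j t) \<le> ?p * cmod (B j t) + sqrt (1 - ?p\<^sup>2) * N"
    by (simp add: norm_mult eqn)
  \<comment> \<open>At 1 only the left-going wave is known; dropping the nonnegative |A|^2 gives a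
    one-sided bound for the flux.\<close>
  have "- cs (n + 1) * F 1 \<le> (cmod (B n 1))\<^sup>2"
    using flux[of n 1, unfolded Suc_eq_plus1] zero_le_power2[of "cmod (A n 1)"] by linarith
  also have "\<dots> = cs (n + 1) * (cs (n + 1) * (cmod g2 / (2 * \<omega>))\<^sup>2)"
    unfolding Bn using cpos[of n] \<omega>
    by (simp add: norm_mult norm_divide power_mult_distrib power_divide power2_eq_square)
  finally have "- F 1 \<le> cs (n + 1) * (cmod g2 / (2 * \<omega>))\<^sup>2"
    using cpos(1)[of n] mult_le_cancel_left_pos[of "cs (n + 1)" "- F 1"] by simp
  then have "cs (Suc j) * (- F 1) \<le> cs (Suc j) * (cs (n + 1) * (cmod g2 / (2 * \<omega>))\<^sup>2)"
    using cpos(1)[OF j] by (intro mult_left_mono) auto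
  also have "\<dots> \<le> N\<^sup>2"
    using amp[OF cpos[OF j] _ _ G(2), of "cs (n + 1)"] cpos[of n] by (simp add: mult.assoc)
  finally have "(cmod (B j t))\<^sup>2 - (cmod (A j t))\<^sup>2 \<le> N\<^sup>2"
    using flux[OF j, of t] F_const[OF j t] by simp
  from amplitude_bound[OF norm_ge_zero p1 N0 norm_ge_zero norm_ge_zero le this]
  show ?thesis
    by (simp add: A_def B_def K_def k_def Q_def N_def)
qed

section \<open>The stability estimate\<close>

lemma has_weak_deriv_0:
  "u locally_integrable_on S \<Longrightarrow> has_weak_deriv S 0 u u"
  by (simp add: has_weak_deriv_def)

text \<open>The weak relation between u and v is tested with \<open>deriv \<phi>\<close>, which is
  again a test function.\<close>

lemma has_weak_deriv_2:
  assumes "has_weak_deriv S 1 u v" "has_weak_deriv S 1 v w"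
  shows "has_weak_deriv S 2 u w"
  using assms by (simp add: has_weak_deriv_def test_functions_deriv numeral_2_eq_2)

theorem theorem10:
  fixes n :: nat and x cs :: "nat \<Rightarrow> real" and c :: "real \<Rightarrow> real"
    and \<omega> \<omega>0 :: real and g1 g2 :: complex and u :: "real \<Rightarrow> complex" and k :: nat
  assumes "n \<ge> 1"
    and "x 0 = -1" and "x (n + 1) = 1"
    and "\<And>j. j \<le> n \<Longrightarrow> x j < x (j + 1)"
    and "\<And>j. j \<in> {1..n + 1} \<Longrightarrow> cs j > 0"
    and "\<And>j t. j \<in> {1..n + 1} \<Longrightarrow> t \<in> {x (j - 1)<..<x j} \<Longrightarrow> c t = cs j"
    and "c (-1) = cs 1" and "c 1 = cs (n + 1)"
    and "\<omega>0 > 0" and "\<omega> \<ge> \<omega>0"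
    and "helmholtz_solution c \<omega> g1 g2 u"
    and "k \<in> {0, 1, 2}"
  shows "u \<in> sobolev Omega k \<and>
    L2_norm_on Omega (weak_deriv Omega k u)
      \<le> 4 * (Max (cs ` {1..n + 1}) / Min (cs ` {1..n + 1}) ^ k) * \<omega> powi (int k - 1)
          * max (cmod g1) (cmod g2)
          * Max ((\<lambda>j. 1 / sqrt (1 - (cmod (Qseq x cs \<omega> j))\<^sup>2)) ` {1..n})"
proof -
  note n1 = assms(1) and x = assms(2,3,4) and cs = assms(5) and c_pieces = assms(6)
    and c_ends = assms(7,8) and sol = assms(11) and k = assms(12)
  have \<omega>: "\<omega> > 0"
    using assms(9,10) by simp
  define cmax where "cmax = Max (cs ` {1..n + 1})"
  define cmin where "cmin = Min (cs ` {1..n + 1})"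
  define G where "G = max (cmod g1) (cmod g2)"
  define M where "M = Max ((\<lambda>j. 1 / sqrt (1 - (cmod (Qseq x cs \<omega> j))\<^sup>2)) ` {1..n})"
  have cmax: "cs j \<le> cmax" if "j \<in> {1..n + 1}" for j
    unfolding cmax_def using that by (intro Max_ge) auto
  have cmin: "cmin \<le> cs j" if "j \<in> {1..n + 1}" for j
    unfolding cmin_def using that by (intro Min_le) auto
  have "cmin \<in> cs ` {1..n + 1}"
    unfolding cmin_def by (rule Min_in) auto
  then have cmin0: "cmin > 0"
    using cs by auto
  have cmax0: "cmax > 0"
    using cs[of 1] cmax[of 1] by simp
  have G0: "G \<ge> 0"
    by (simp add: G_def le_max_iff_disj)
  have M: "1 / sqrt (1 - (cmod (Qseq x cs \<omega> j))\<^sup>2) \<le> M" if "j \<in> {1..n}" for j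
    unfolding M_def using that by (intro Max_ge) auto
  have Q1: "(cmod (Qseq x cs \<omega> j))\<^sup>2 < 1" if "j \<le> n" for j
    using cmod_Qseq_less_1[of n cs j x \<omega>] cs that by (simp add: abs_square_less_1)
  \<comment> \<open>The maximum runs over indices from 1, while the first layer carries index 0 with
    value Q = 0. Its factor is 1, so M >= 1 covers it.\<close>
  have "1 \<le> 1 / sqrt (1 - (cmod (Qseq x cs \<omega> 1))\<^sup>2)"
    using Q1[of 1] n1 by (simp add: divide_simps)
  with M[of 1] n1 have M1: "1 \<le> M"
    by simp
  have M': "1 / sqrt (1 - (cmod (Qseq x cs \<omega> j))\<^sup>2) \<le> M" if "j \<le> n" for j
    using M[of j] M1 that by (cases "j = 0") auto
  define S where "S = x ` {..n + 1}"
  \<comment> \<open>A Borel version of the squared wave number, built from the layers alone. It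
    vanishes at the nodes, where \<open>c\<close> may take any value in the interior.\<close>
  define e where "e = (\<lambda>t. \<Sum>j\<in>{1..n + 1}. indicator {x (j - 1)<..<x j} t * (\<omega> / cs j)\<^sup>2)"
  have S: "finite S"
    by (simp add: S_def)
  have mono: "x i \<le> x j" if "i \<le> j" "j \<le> n + 1" for i j
    using partition_mono[of n x j i] x(3) that by simp
  have e_piece: "e t = (\<omega> / cs (Suc j))\<^sup>2" if "j \<le> n" "t \<in> {x j<..<x (Suc j)}" for j t
  proof -
    have "t \<notin> {x (i - 1)<..<x i}" if i: "i \<in> {1..n + 1} - {Suc j}" for i
    proof (cases "i \<le> j")
      case True
      then show ?thesis
        using mono[of i j] \<open>j \<le> n\<close> \<open>t \<in> {x j<..<x (Suc j)}\<close> by auto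
    next
      case False
      then have "Suc j \<le> i - 1" "i - 1 \<le> n + 1"
        using i by auto
      then show ?thesis
        using mono[of "Suc j" "i - 1"] \<open>t \<in> {x j<..<x (Suc j)}\<close> by auto
    qed
    then have "e t = (\<Sum>i\<in>{Suc j}. indicator {x (i - 1)<..<x i} t * (\<omega> / cs i)\<^sup>2)"
      unfolding e_def using that by (intro sum.mono_neutral_right) auto
    also have "\<dots> = indicator {x j<..<x (Suc j)} t * (\<omega> / cs (Suc j))\<^sup>2"
      by (simp only: sum.insert finite.emptyI empty_iff not_False_eq_True sum.empty add_0_right diff_Suc_1)
    also have "\<dots> = (\<omega> / cs (Suc j))\<^sup>2"
      using that by simp
    finally show ?thesis .
  qed
  have cover: "\<exists>j\<le>n. t \<in> {x j..x (Suc j)}" if "t \<in> {-1..1}" for t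
    using partition_cover[of x t n] x that by (metis Suc_eq_plus1 atLeastAtMost_iff)
  have cover': "\<exists>j\<le>n. t \<in> {x j<..<x (Suc j)}" if t: "t \<in> Omega - S" for t
  proof -
    obtain j where j: "j \<le> n" "t \<in> {x j..x (Suc j)}"
      using cover[of t] t by auto
    then have "t \<noteq> x j" "t \<noteq> x (Suc j)"
      using t by (auto simp: S_def)
    with j show ?thesis
      by (intro exI[of _ j]) auto
  qed
  have e_nodes: "e t = 0" if t: "t \<in> S" for t
  proof -
    obtain i where i: "i \<le> n + 1" "t = x i"
      using t by (auto simp: S_def)
    have "t \<notin> {x (j - 1)<..<x j}" if j: "j \<in> {1..n + 1}" for j
    proof (cases "i < j")
      case True
      then have "i \<le> j - 1" "j - 1 \<le> n + 1"
        using j by auto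
      then show ?thesis
        using mono[of i "j - 1"] i by auto
    next
      case False
      then show ?thesis
        using mono[of j i] i by auto
    qed
    then show ?thesis
      unfolding e_def by (intro sum.neutral) auto
  qed
  have piece_bounds: "0 < cs (Suc j)" "cmin \<le> cs (Suc j)" if "j \<le> n" for j
    using cs[of "Suc j"] cmin[of "Suc j"] that by auto
  have \<omega>c: "\<omega> / cs (Suc j) \<le> \<omega> / cmin" if "j \<le> n" for j
    using piece_bounds[OF that] cmin0 \<omega> by (intro divide_left_mono) auto
  have e_bound: "\<bar>e t\<bar> \<le> (\<omega> / cmin)\<^sup>2" if t: "t \<in> Omega" for t
  proof (cases "t \<in> S")
    case False
    with t obtain j where j: "j \<le> n" "t \<in> {x j<..<x (Suc j)}"
      using cover'[of t] by auto
    then show ?thesis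
      using e_piece[OF j] \<omega>c[OF j(1)] piece_bounds[OF j(1)] \<omega> by (simp only: abs_power2) (intro power_mono, auto)
  qed (simp add: e_nodes)
  have e_meas: "e \<in> borel_measurable borel"
    unfolding e_def by measurable
  have e_c: "(\<omega> / c t)\<^sup>2 = e t" if t: "t \<in> Omega - S" for t
  proof -
    obtain j where j: "j \<le> n" "t \<in> {x j<..<x (Suc j)}"
      using cover'[OF t] by blast
    then show ?thesis
      using e_piece[OF j] c_pieces[of "Suc j" t] by simp
  qed
  have e_cont: "isCont e t" if t: "t \<in> Omega - S" for t
  proof -
    obtain j where j: "j \<le> n" "t \<in> {x j<..<x (Suc j)}"
      using cover'[OF t] by blast
    have "continuous_on {x j<..<x (Suc j)} e \<longleftrightarrow> continuous_on {x j<..<x (Suc j)} (\<lambda>_. (\<omega> / cs (Suc j))\<^sup>2)"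
      using e_piece[OF j(1)] by (intro continuous_on_cong) auto
    then show ?thesis
      using j(2) by (simp add: continuous_on_eq_continuous_at)
  qed
  obtain P where uc: "continuous_on {-1..1} u" and Pc: "continuous_on {-1..1} P"
    and ud: "\<And>t. t \<in> Omega - S \<Longrightarrow> (u has_vector_derivative P t) (at t)"
    and Pd: "\<And>t. t \<in> Omega - S \<Longrightarrow> (P has_vector_derivative - (of_real (e t) * u t)) (at t)"
    and bc: "P (-1) = - g1 - \<i> * of_real (\<omega> / c (-1)) * u (-1)"
      "P 1 = g2 + \<i> * of_real (\<omega> / c 1) * u 1"
    by (rule helmholtz_solution_classical[OF sol e_meas e_bound S e_c e_cont])
      (assumption+, rule that)
  have piece_sub: "t \<in> Omega - S" if j: "j \<le> n" "t \<in> {x j<..<x (Suc j)}" for j t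
  proof -
    have "t \<noteq> x i" if "i \<le> n + 1" for i
      using mono[of i j] mono[of "Suc j" i] that j by (cases "i \<le> j") auto
    moreover have "-1 < t" "t < 1"
      using mono[of 0 j] mono[of "Suc j" "n + 1"] x(1,2) j by auto
    ultimately show ?thesis
      by (auto simp: S_def)
  qed
  \<comment> \<open>A bound for |A| + |B| uniform over all layers. It controls u = A + B directly
    and P = i k (A - B) up to the largest wave number \<omega> / \<open>cmin\<close>.\<close>
  define U where "U = 2 * (1 + sqrt 2) * (cmax * G / (2 * \<omega>)) * M"
  have wave: "cmod (u t) \<le> U" "cmod (P t) \<le> \<omega> / cmin * U" if t: "t \<in> Omega" for t
  proof -
    obtain j where j: "j \<le> n" "t \<in> {x j..x (Suc j)}"
      using cover[of t] t by auto
    let ?k = "\<omega> / cs (Suc j)"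
    let ?s = "cmod (right_wave ?k u P t) + cmod (left_wave ?k u P t)"
    have "?s \<le> 2 * (1 + sqrt 2) * (cmax * G / (2 * \<omega>)) * (1 / sqrt (1 - (cmod (Qseq x cs \<omega> j))\<^sup>2))"
    proof (rule layered_wave_bound[OF x cs cmax \<omega> uc Pc _ _ _ _ _ _ j])
      show "(u has_vector_derivative P t) (at t)" if "j \<le> n" "t \<in> {x j<..<x (Suc j)}" for j t
        by (rule ud[OF piece_sub[OF that]])
      show "(P has_vector_derivative - (of_real ((\<omega> / cs (Suc j))\<^sup>2) * u t)) (at t)"
        if "j \<le> n" "t \<in> {x j<..<x (Suc j)}" for j t
        using Pd[OF piece_sub[OF that]] unfolding e_piece[OF that] .
      show "P (-1) = - g1 - \<i> * of_real (\<omega> / cs 1) * u (-1)" "P 1 = g2 + \<i> * of_real (\<omega> / cs (n + 1)) * u 1"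
        using bc unfolding c_ends .
      show "cmod g1 \<le> G" "cmod g2 \<le> G"
        unfolding G_def by (rule max.cobounded1, rule max.cobounded2)
    qed
    also have "\<dots> \<le> U"
      unfolding U_def using M'[OF j(1)] cmax0 G0 \<omega> by (intro mult_left_mono) auto
    finally have s: "?s \<le> U" .
    have "cmod (u t) \<le> ?s"
      using norm_triangle_ineq[of "right_wave ?k u P t" "left_wave ?k u P t"] by (simp add: wave_sum)
    with s show "cmod (u t) \<le> U"
      by simp
    have kpos: "?k > 0"
      using piece_bounds[OF j(1)] \<omega> by simp
    have "cmod (P t) = cmod (\<i> * of_real ?k * (right_wave ?k u P t - left_wave ?k u P t))"
      by (simp only: wave_diff[OF less_imp_neq[OF kpos, THEN not_sym]])
    also have "\<dots> = ?k * cmod (right_wave ?k u P t - left_wave ?k u P t)"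
      unfolding norm_mult norm_ii norm_of_real abs_of_pos[OF kpos] by (simp only: mult_1_left)
    also have "\<dots> \<le> \<omega> / cmin * U"
      using \<omega>c[OF j(1)] kpos s norm_triangle_ineq4[of "right_wave ?k u P t" "left_wave ?k u P t"]
      by (intro mult_mono) auto
    finally show "cmod (P t) \<le> \<omega> / cmin * U" .
  qed
  define w where "w = (\<lambda>t. - (of_real (e t) * u t))"
  have um: "u \<in> borel_measurable (lebesgue_on Omega)" and Pm: "P \<in> borel_measurable (lebesgue_on Omega)"
    using uc Pc by (auto intro: continuous_measurable_Omega)
  have "e \<in> borel_measurable (lebesgue_on Omega)"
    using e_meas by (simp add: measurable_completion measurable_restrict_space1)
  then have wm: "w \<in> borel_measurable (lebesgue_on Omega)"
    unfolding w_def using um by measurable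
  have wb: "cmod (w t) \<le> (\<omega> / cmin)\<^sup>2 * U" if "t \<in> Omega" for t
    unfolding w_def norm_minus_cancel norm_mult norm_of_real
    by (intro mult_mono e_bound wave that) auto
  have D0: "has_weak_deriv Omega 0 u u"
    by (intro has_weak_deriv_0 integrable_imp_locally_integrable_Omega continuous_integrable_Omega uc)
  have D1: "has_weak_deriv Omega 1 u P"
    by (rule piecewise_C1_has_weak_deriv[OF uc S ud Pm wave(2)])
  \<comment> \<open>P is itself continuous and piecewise C1, so the same lemma yields the second
    derivative; the jumps of the coefficient contribute no point masses.\<close>
  have "has_weak_deriv Omega 1 P w"
    by (rule piecewise_C1_has_weak_deriv[OF Pc S _ wm wb]) (simp add: Pd w_def)
  with D1 have D2: "has_weak_deriv Omega 2 u w"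
    by (rule has_weak_deriv_2)
  have sq: "u square_integrable_on Omega" "P square_integrable_on Omega" "w square_integrable_on Omega"
    using bounded_square_integrable_Omega um Pm wm wave wb by blast+
  have "u \<in> sobolev Omega k"
  proof -
    have "\<exists>v. has_weak_deriv Omega j u v \<and> v square_integrable_on Omega" if "j \<in> {1..k}" for j
    proof -
      from that k have "j = 1 \<or> j = 2" by auto
      then show ?thesis
        using D1 D2 sq by auto
    qed
    then show ?thesis
      using sq(1) by (simp add: sobolev_def)
  qed
  moreover have L2: "L2_norm_on Omega (weak_deriv Omega k u) \<le> sqrt 2 * ((\<omega> / cmin) ^ k * U)"
  proof -
    consider "k = 0" | "k = 1" | "k = 2"
      using k by auto
    then show ?thesis
    proof cases
      case 1
      then show ?thesis
        using L2_norm_Omega_le[OF um wave(1) weak_deriv_AE_eq[OF D0]] by simp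
    next
      case 2
      then show ?thesis
        using L2_norm_Omega_le[OF Pm wave(2) weak_deriv_AE_eq[OF D1]] by simp
    next
      case 3
      then show ?thesis
        using L2_norm_Omega_le[OF wm wb weak_deriv_AE_eq[OF D2]] by simp
    qed
  qed
  moreover have "sqrt 2 * ((\<omega> / cmin) ^ k * U) \<le> 4 * (cmax / cmin ^ k) * \<omega> powi (int k - 1) * G * M"
  proof -
    \<comment> \<open>The integer power is needed for k = 0, where the exponent is -1.\<close>
    have p: "\<omega> powi (int k - 1) = \<omega> ^ k / \<omega>"
      using \<omega> by (simp add: power_int_diff)
    have "sqrt 2 \<le> (3 / 2 :: real)"
      by (rule real_le_lsqrt) (auto simp: power2_eq_square)
    then have "sqrt 2 * (1 + sqrt 2) \<le> (4 :: real)"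
      by (simp add: distrib_left)
    then have "(sqrt 2 * (1 + sqrt 2)) * (cmax / cmin ^ k * (\<omega> ^ k / \<omega>) * G * M) \<le>
        4 * (cmax / cmin ^ k * (\<omega> ^ k / \<omega>) * G * M)"
      using cmax0 cmin0 \<omega> G0 M1 by (intro mult_right_mono) auto
    \<comment> \<open>The factor 2 in \<open>U\<close> cancels against 2 \<omega>; together with the
      square root of the interval length this leaves sqrt 2 (1 + sqrt 2) = 2 + sqrt 2.\<close>
    moreover have "sqrt 2 * ((\<omega> / cmin) ^ k * U) =
        (sqrt 2 * (1 + sqrt 2)) * (cmax / cmin ^ k * (\<omega> ^ k / \<omega>) * G * M)"
      unfolding U_def power_divide using cmin0 \<omega> by (simp add: field_simps)
    ultimately show ?thesis
      unfolding p by (simp add: mult.assoc)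
  qed
  ultimately show ?thesis
    unfolding cmax_def cmin_def G_def M_def by linarith
qed

end
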